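(* Given any numbers $a,b\in\mathbb{R}$, consider the doubly parameterized family of fractional differential equations $$m_t+u\,m_x+b\,u_x\,m=0,\quad t>0,\ x\in\mathbb{S}^1,\qquad m=\Lambda^a_\mu u, \qquad ( * )$$ and assume that there is an inertia operator $A_{a,b}\in\mathcal{L}^{sym}_{is}(C^\infty(\mathbb{S}^1))$ such that $( * )$ is the Euler equation on $\mathrm{Diff}^\infty(\mathbb{S}^1)$ with respect to the metric $\rho_{A_{a,b}}$ induced by $A_{a,b}$. If either $a\in\mathbb{R}\setminus\{1\}$, or $a=1$ and $b\in[-1,\infty)$, then $b=2$ and $A_{a,2}=\Lambda^a_\mu$.
   Context: $\mathbb{S}^1=\mathbb{R}/\mathbb{Z}$ is the circle of length $1$, and $C^\infty(\mathbb{S}^1)$ is the space of smooth functions on it. $\mathrm{Diff}^\infty(\mathbb{S}^1)$ is the Fréchet Lie group of all smooth orientation-preserving diffeomorphisms of $\mathbb{S}^1$; its Lie algebra (the smooth vector fields on $\mathbb{S}^1$) is identified with $C^\infty(\mathbb{S}^1)$, with bracket $[u,v]=u_xv-uv_x$. Operators: $\mu(u)=\int_{\mathbb{S}^1}u(x)\,dx$ (regarded as a constant function). For $a\neq 0$, $(-\Delta)^{a/2}$ is the Fourier multiplication operator that multiplies the $k$-th Fourier coefficient by $|k|^a$ for $k\in\mathbb{Z}\setminus\{0\}$ and annihilates constants, and $\Lambda^a_\mu u=(-\Delta)^{a/2}u+\mu(u)$. For $a=0$, $\Lambda^0_\mu=\mathrm{id}$. $\mathcal{L}^{sym}_{is}(C^\infty(\mathbb{S}^1))$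 is the set of all continuous isomorphisms of $C^\infty(\mathbb{S}^1)$ that are symmetric with respect to the $L_2(\mathbb{S}^1)$ inner product; its elements are called regular inertia operators. Each $\Lambda^a_\mu$ belongs to this set. For a regular inertia operator $A$, $\rho_A$ is the right-invariant metric on $\mathrm{Diff}^\infty(\mathbb{S}^1)$ given at the identity by $(u,v)\mapsto\int_{\mathbb{S}^1}(Au)v\,dx$. The Euler equation with respect to $\rho_A$ is $u_t=-B(u,u)$, where $B(u,v)=\tfrac12A^{-1}[2Au\cdot v_x+2Av\cdot u_x+u\cdot(Av)_x+v\cdot(Au)_x]$. Saying that $( * )$ is this Euler equation means that $$A^{-1}\big[2(Au)u_x+u(Au)_x\big]=(\Lambda^a_\mu)^{-1}\big[b\,(\Lambda^a_\mu u)\,u_x+u\,(\Lambda^a_\mu u)_x\big]\quad\text{for all }u\in C^\infty(\mathbb{S}^1).$$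
   Formalization: The conclusion A_{a,2} = Λ^a_μ is replaced by A = cΛ^a_μ for some constant c ≠ 0: the Euler equation is unchanged when A is multiplied by a nonzero constant, so A = 2Λ^a_μ with b = 2 meets all hypotheses but is not Λ^a_μ; equality holds when A(1) = 1. *)

theory Defs
  imports "HOL-Analysis.Analysis"
begin

section \<open>Smooth functions on the circle\<close>

text \<open>Functions on the circle of length 1 are functions on the real line with period 1.\<close>

definition Cinf_circle :: "(real \<Rightarrow> real) set" where
  "Cinf_circle = {u. (\<forall>x. u (x + 1) = u x) \<and>
                     (\<forall>n x. (deriv ^^ n) u field_differentiable (at x))}"

definition Cinf_seminorm :: "nat \<Rightarrow> (real \<Rightarrow> real) \<Rightarrow> real" where
  "Cinf_seminorm n u = (SUP x\<in>{0..1}. \<bar>(deriv ^^ n) u x\<bar>)"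

text \<open>The usual Frechet topology, with the balls of the seminorms as a subbase.\<close>

definition Cinf_ball :: "(real \<Rightarrow> real) \<Rightarrow> nat \<Rightarrow> real \<Rightarrow> (real \<Rightarrow> real) set" where
  "Cinf_ball u n r = {v \<in> Cinf_circle. Cinf_seminorm n (\<lambda>x. v x - u x) < r}"

definition Cinf_topology :: "(real \<Rightarrow> real) topology" where
  "Cinf_topology = topology_generated_by {Cinf_ball u n r |u n r. u \<in> Cinf_circle \<and> 0 < r}"

definition L2_inner :: "(real \<Rightarrow> real) \<Rightarrow> (real \<Rightarrow> real) \<Rightarrow> real" where
  "L2_inner u v = integral {0..1} (\<lambda>x. u x * v x)"


section \<open>The operators \<open>\<Lambda>\<^sub>\<mu>\<close>\<close>

definition mean :: "(real \<Rightarrow> real) \<Rightarrow> real" where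
  "mean u = integral {0..1} u"

definition fourier_coeff :: "(real \<Rightarrow> real) \<Rightarrow> int \<Rightarrow> complex" where
  "fourier_coeff u k =
     integral {0..1} (\<lambda>x. complex_of_real (u x) * cis (- (2 * pi * of_int k * x)))"

text \<open>On smooth functions the series converges absolutely, and its sum is real because the
  coefficients at \<open>k\<close> and \<open>- k\<close> are conjugate; \<open>Re\<close> only adjusts the type. As in the source,
  the symbol is \<open>\<bar>k\<bar>\<close> to the power \<open>a\<close>, without powers of \<open>2 * pi\<close>.\<close>

definition fractional_laplacian :: "real \<Rightarrow> (real \<Rightarrow> real) \<Rightarrow> real \<Rightarrow> real" where
  "fractional_laplacian a u = (\<lambda>x.
     Re (\<Sum>\<^sub>\<infinity>k\<in>UNIV - {0::int}.
           complex_of_real (\<bar>of_int k\<bar> powr a) * fourier_coeff u k * cis (2 * pi * of_int k * x)))"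

definition Lambda_mu :: "real \<Rightarrow> (real \<Rightarrow> real) \<Rightarrow> real \<Rightarrow> real" where
  "Lambda_mu a u = (if a = 0 then u else (\<lambda>x. fractional_laplacian a u x + mean u))"


section \<open>Regular inertia operators\<close>

text \<open>An operator is a function on all of \<open>real \<Rightarrow> real\<close>, of which only the restriction to
  \<open>Cinf_circle\<close> matters. Continuity of the inverse is not required separately: it is automatic
  by the open mapping theorem for Frechet spaces.\<close>

definition regular_inertia_operators :: "((real \<Rightarrow> real) \<Rightarrow> real \<Rightarrow> real) set" where
  "regular_inertia_operators = {A.
     bij_betw A Cinf_circle Cinf_circle \<and>
     (\<forall>u\<in>Cinf_circle. \<forall>v\<in>Cinf_circle. A (\<lambda>x. u x + v x) = (\<lambda>x. A u x + A v x)) \<and>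
     (\<forall>c. \<forall>u\<in>Cinf_circle. A (\<lambda>x. c * u x) = (\<lambda>x. c * A u x)) \<and>
     continuous_map Cinf_topology Cinf_topology A \<and>
     (\<forall>u\<in>Cinf_circle. \<forall>v\<in>Cinf_circle. L2_inner (A u) v = L2_inner u (A v))}"

abbreviation op_inverse ::
  "((real \<Rightarrow> real) \<Rightarrow> real \<Rightarrow> real) \<Rightarrow> (real \<Rightarrow> real) \<Rightarrow> real \<Rightarrow> real" where
  "op_inverse A \<equiv> inv_into Cinf_circle A"


section \<open>Euler equations\<close>

text \<open>The Euler equation of the right-invariant metric induced by \<open>A\<close> is
  \<open>u\<^sub>t = - euler_bilinear A u u\<close>.\<close>

definition euler_bilinear ::
  "((real \<Rightarrow> real) \<Rightarrow> real \<Rightarrow> real) \<Rightarrow> (real \<Rightarrow> real) \<Rightarrow> (real \<Rightarrow> real) \<Rightarrow> real \<Rightarrow> real" where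
  "euler_bilinear A u v = (\<lambda>x. 1/2 * op_inverse A
     (\<lambda>y. 2 * A u y * deriv v y + 2 * A v y * deriv u y + u y * deriv (A v) y + v y * deriv (A u) y) x)"

text \<open>Solved for \<open>u\<^sub>t\<close>, the equation \<open>m\<^sub>t + u m\<^sub>x + b u\<^sub>x m = 0\<close> with \<open>m = Lambda_mu a u\<close>
  reads \<open>u\<^sub>t = - family_quadratic a b u\<close>.\<close>

definition family_quadratic :: "real \<Rightarrow> real \<Rightarrow> (real \<Rightarrow> real) \<Rightarrow> real \<Rightarrow> real" where
  "family_quadratic a b u = op_inverse (Lambda_mu a)
     (\<lambda>y. b * Lambda_mu a u y * deriv u y + u y * deriv (Lambda_mu a u) y)"

definition is_euler_equation ::
  "real \<Rightarrow> real \<Rightarrow> ((real \<Rightarrow> real) \<Rightarrow> real \<Rightarrow> real) \<Rightarrow> bool" where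
  "is_euler_equation a b A \<longleftrightarrow>
     (\<forall>u\<in>Cinf_circle. euler_bilinear A u u = family_quadratic a b u)"


section \<open>The quadratic form of the Euler equation, and its scaling invariance\<close>

lemma iter_deriv_differentiable_Suc:
  "(\<forall>k\<le>Suc n. \<forall>x. (deriv ^^ k) u field_differentiable (at x)) \<longleftrightarrow>
   (\<forall>x. u field_differentiable (at x)) \<and>
   (\<forall>k\<le>n. \<forall>x. (deriv ^^ k) (deriv u) field_differentiable (at x))" (is "?L \<longleftrightarrow> ?R")
proof
  assume L: ?L
  have "(deriv ^^ k) (deriv u) field_differentiable (at x)" if "k \<le> n" for k x
    using L[rule_format, of "Suc k" x] that by (simp add: funpow_swap1)
  moreover have "u field_differentiable (at x)" for x
    using L[rule_format, of 0 x] by simp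
  ultimately show ?R by blast
next
  assume R: ?R
  show ?L
  proof (intro allI impI)
    fix k x assume "k \<le> Suc n"
    then show "(deriv ^^ k) u field_differentiable (at x)"
      using R by (cases k) (auto simp: funpow_swap1)
  qed
qed

lemma iter_deriv_differentiable_add:
  fixes f g :: "real \<Rightarrow> real"
  assumes "\<forall>k\<le>n. \<forall>x. (deriv ^^ k) f field_differentiable (at x)"
    and "\<forall>k\<le>n. \<forall>x. (deriv ^^ k) g field_differentiable (at x)"
  shows "\<forall>k\<le>n. \<forall>x. (deriv ^^ k) (\<lambda>y. f y + g y) field_differentiable (at x)"
  using assms
proof (induction n arbitrary: f g)
  case 0
  then show ?case by (auto intro: field_differentiable_add)
next
  case (Suc n)
  from Suc.prems have f: "\<forall>x. f field_differentiable (at x)" and g: "\<forall>x. g field_differentiable (at x)"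
    unfolding iter_deriv_differentiable_Suc by blast+
  then have "deriv (\<lambda>y. f y + g y) = (\<lambda>y. deriv f y + deriv g y)" by (intro ext) simp
  with Suc f g show ?case
    unfolding iter_deriv_differentiable_Suc by (auto intro: field_differentiable_add)
qed

lemma iter_deriv_differentiable_mult:
  fixes f g :: "real \<Rightarrow> real"
  assumes "\<forall>k\<le>n. \<forall>x. (deriv ^^ k) f field_differentiable (at x)"
    and "\<forall>k\<le>n. \<forall>x. (deriv ^^ k) g field_differentiable (at x)"
  shows "\<forall>k\<le>n. \<forall>x. (deriv ^^ k) (\<lambda>y. f y * g y) field_differentiable (at x)"
  using assms
proof (induction n arbitrary: f g)
  case 0
  then show ?case by (auto intro: field_differentiable_mult)
next
  case (Suc n)
  from Suc.prems have f: "\<forall>x. f field_differentiable (at x)" and g: "\<forall>x. g field_differentiable (at x)"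
    and f': "\<forall>k\<le>n. \<forall>x. (deriv ^^ k) (deriv f) field_differentiable (at x)"
    and g': "\<forall>k\<le>n. \<forall>x. (deriv ^^ k) (deriv g) field_differentiable (at x)"
    unfolding iter_deriv_differentiable_Suc by blast+
  have fn: "\<forall>k\<le>n. \<forall>x. (deriv ^^ k) f field_differentiable (at x)"
    and gn: "\<forall>k\<le>n. \<forall>x. (deriv ^^ k) g field_differentiable (at x)"
    using Suc.prems by auto
  have eq: "deriv (\<lambda>y. f y * g y) = (\<lambda>y. f y * deriv g y + deriv f y * g y)"
    using f g by (intro ext) simp
  have "\<forall>k\<le>n. \<forall>x. (deriv ^^ k) (deriv (\<lambda>y. f y * g y)) field_differentiable (at x)"
    unfolding eq by (intro iter_deriv_differentiable_add Suc.IH fn gn f' g')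
  with f g show ?case
    unfolding iter_deriv_differentiable_Suc by (auto intro: field_differentiable_mult)
qed

lemma Cinf_circle_add:
  assumes "u \<in> Cinf_circle" "v \<in> Cinf_circle"
  shows "(\<lambda>x. u x + v x) \<in> Cinf_circle"
  using assms iter_deriv_differentiable_add[of _ u v] unfolding Cinf_circle_def by fastforce

lemma Cinf_circle_mult:
  assumes "u \<in> Cinf_circle" "v \<in> Cinf_circle"
  shows "(\<lambda>x. u x * v x) \<in> Cinf_circle"
  using assms iter_deriv_differentiable_mult[of _ u v] unfolding Cinf_circle_def by fastforce

lemma Cinf_circle_const: "(\<lambda>x. c) \<in> Cinf_circle"
proof -
  have "(deriv ^^ n) (\<lambda>x::real. c) \<in> range (\<lambda>d x. d)" for n
  proof (induction n)
    case (Suc n)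
    then obtain d where "(deriv ^^ n) (\<lambda>x::real. c) = (\<lambda>x. d)" by auto
    then have "(deriv ^^ Suc n) (\<lambda>x::real. c) = (\<lambda>x. 0)" by simp
    then show ?case by blast
  qed auto
  then have "(deriv ^^ n) (\<lambda>x::real. c) field_differentiable (at x)" for n x
    by (metis field_differentiable_const imageE)
  then show ?thesis by (simp add: Cinf_circle_def)
qed

lemma Cinf_circle_cmult: "u \<in> Cinf_circle \<Longrightarrow> (\<lambda>x. c * u x) \<in> Cinf_circle"
  by (rule Cinf_circle_mult[OF Cinf_circle_const])

lemma Cinf_circle_deriv:
  assumes "u \<in> Cinf_circle"
  shows "deriv u \<in> Cinf_circle"
proof -
  have d: "(u has_field_derivative deriv u y) (at y)" for y
    using assms[unfolded Cinf_circle_def] DERIV_deriv_iff_field_differentiable[of u y]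
    by (metis (mono_tags, lifting) funpow_0 mem_Collect_eq)
  have per: "(\<lambda>y. u (y + 1)) = u" using assms by (auto simp: Cinf_circle_def)
  have "deriv u (x + 1) = deriv u x" for x
  proof -
    have "((\<lambda>y. u (y + 1)) has_field_derivative deriv u (x + 1)) (at x)"
      using d[of "x + 1"] by (simp only: DERIV_shift)
    then show ?thesis unfolding per by (metis DERIV_imp_deriv)
  qed
  moreover have "(deriv ^^ n) (deriv u) field_differentiable (at x)" for n x
    using assms unfolding Cinf_circle_def
    by (metis (mono_tags, lifting) funpow_Suc_right comp_apply mem_Collect_eq)
  ultimately show ?thesis by (simp add: Cinf_circle_def)
qed

lemma op_inverse_cmult:
  assumes A: "A \<in> regular_inertia_operators" and w: "w \<in> Cinf_circle"
  shows "op_inverse A (\<lambda>x. c * w x) = (\<lambda>x. c * op_inverse A w x)"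
proof -
  have bij: "bij_betw A Cinf_circle Cinf_circle" using A by (simp add: regular_inertia_operators_def)
  have v: "op_inverse A w \<in> Cinf_circle" "A (op_inverse A w) = w"
    using bij w by (auto simp: bij_betw_def inv_into_into f_inv_into_f)
  then have "A (\<lambda>x. c * op_inverse A w x) = (\<lambda>x. c * w x)"
    using A by (simp add: regular_inertia_operators_def)
  then show ?thesis
    by (metis v(1) Cinf_circle_cmult bij bij_betw_inv_into_left)
qed

lemma euler_rhs_in_Cinf:
  assumes A: "A \<in> regular_inertia_operators" and u: "u \<in> Cinf_circle"
  shows "(\<lambda>y. 2 * A u y * deriv u y + u y * deriv (A u) y) \<in> Cinf_circle"
proof -
  have "A u \<in> Cinf_circle" using A u by (auto simp: regular_inertia_operators_def bij_betw_def)
  then show ?thesis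
    by (intro Cinf_circle_add Cinf_circle_mult Cinf_circle_cmult Cinf_circle_deriv u)
qed

lemma euler_bilinear_diag:
  assumes A: "A \<in> regular_inertia_operators" and u: "u \<in> Cinf_circle"
  shows "euler_bilinear A u u = op_inverse A (\<lambda>y. 2 * A u y * deriv u y + u y * deriv (A u) y)"
proof -
  have "(\<lambda>y. 2 * A u y * deriv u y + 2 * A u y * deriv u y + u y * deriv (A u) y + u y * deriv (A u) y)
      = (\<lambda>y. 2 * (2 * A u y * deriv u y + u y * deriv (A u) y))"
    by (intro ext) (simp add: algebra_simps)
  then show ?thesis
    unfolding euler_bilinear_def
    by (simp only: op_inverse_cmult[OF A euler_rhs_in_Cinf[OF A u]]) simp
qed

lemma is_euler_equation_iff:
  assumes "A \<in> regular_inertia_operators"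
  shows "is_euler_equation a b A \<longleftrightarrow>
    (\<forall>u\<in>Cinf_circle.
       op_inverse A (\<lambda>y. 2 * A u y * deriv u y + u y * deriv (A u) y) =
       op_inverse (Lambda_mu a)
         (\<lambda>y. b * Lambda_mu a u y * deriv u y + u y * deriv (Lambda_mu a u) y))"
  unfolding is_euler_equation_def family_quadratic_def
  using euler_bilinear_diag[OF assms] by simp

text \<open>The Euler equation of \<open>A\<close> does not change when \<open>A\<close> is multiplied by a nonzero constant.
  Hence it can determine the inertia operator only up to such a factor.\<close>

lemma iter_deriv_cmult:
  assumes "u \<in> Cinf_circle"
  shows "(deriv ^^ n) (\<lambda>x. c * u x) = (\<lambda>x. c * (deriv ^^ n) u x)"
proof (induction n)
  case (Suc n)
  have "(deriv ^^ n) u field_differentiable (at x)" for x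
    using assms by (simp add: Cinf_circle_def)
  then show ?case by (simp add: Suc)
qed simp

lemma Cinf_seminorm_cmult_le:
  assumes u: "u \<in> Cinf_circle"
  shows "Cinf_seminorm n (\<lambda>x. c * u x) \<le> \<bar>c\<bar> * Cinf_seminorm n u"
proof -
  have "(deriv ^^ n) u field_differentiable (at x)" for x
    using u by (simp add: Cinf_circle_def)
  then have "continuous_on {0..1} (\<lambda>x. \<bar>(deriv ^^ n) u x\<bar>)"
    by (intro continuous_on_rabs continuous_at_imp_continuous_on)
       (auto intro: field_differentiable_imp_continuous_at)
  then have bdd: "bdd_above ((\<lambda>x. \<bar>(deriv ^^ n) u x\<bar>) ` {0..1})"
    by (intro bounded_imp_bdd_above compact_imp_bounded compact_continuous_image) auto
  show ?thesis
    unfolding Cinf_seminorm_def iter_deriv_cmult[OF u] abs_mult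
    by (intro cSUP_least mult_left_mono cSUP_upper[OF _ bdd]) auto
qed

lemma Cinf_seminorm_cmult:
  assumes u: "u \<in> Cinf_circle" and c: "c \<noteq> 0"
  shows "Cinf_seminorm n (\<lambda>x. c * u x) = \<bar>c\<bar> * Cinf_seminorm n u"
proof (rule antisym[OF Cinf_seminorm_cmult_le[OF u]])
  have "Cinf_seminorm n (\<lambda>x. inverse c * (c * u x)) \<le> \<bar>inverse c\<bar> * Cinf_seminorm n (\<lambda>x. c * u x)"
    by (rule Cinf_seminorm_cmult_le[OF Cinf_circle_cmult[OF u]])
  moreover have "(\<lambda>x. inverse c * (c * u x)) = u" using c by (intro ext) simp
  ultimately show "\<bar>c\<bar> * Cinf_seminorm n u \<le> Cinf_seminorm n (\<lambda>x. c * u x)"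
    using c by (simp add: field_simps)
qed

lemma topspace_Cinf_topology: "topspace Cinf_topology = Cinf_circle"
proof -
  have "Cinf_ball u 0 1 \<in> {Cinf_ball u n r |u n r. u \<in> Cinf_circle \<and> 0 < r}"
    and "u \<in> Cinf_ball u 0 1" if "u \<in> Cinf_circle" for u
    using that zero_less_one by (blast, simp add: Cinf_ball_def Cinf_seminorm_def)
  then have "Cinf_circle \<subseteq> \<Union>{Cinf_ball u n r |u n r. u \<in> Cinf_circle \<and> 0 < r}"
    by (intro subsetI UnionI)
  moreover have "\<Union>{Cinf_ball u n r |u n r. u \<in> Cinf_circle \<and> 0 < r} \<subseteq> Cinf_circle"
    by (auto simp: Cinf_ball_def)
  ultimately show ?thesis
    unfolding Cinf_topology_def topology_generated_by_topspace by (rule antisym[rotated])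
qed

lemma continuous_map_cmult:
  assumes c: "c \<noteq> 0"
  shows "continuous_map Cinf_topology Cinf_topology (\<lambda>u x. c * u x)"
proof -
  have "openin Cinf_topology ((\<lambda>u x. c * u x) -` Cinf_ball u n r \<inter> Cinf_circle)"
    if u: "u \<in> Cinf_circle" and r: "0 < r" for u n r
  proof -
    have "(\<lambda>u x. c * u x) -` Cinf_ball u n r \<inter> Cinf_circle
          = Cinf_ball (\<lambda>x. inverse c * u x) n (r / \<bar>c\<bar>)"
    proof -
      have "Cinf_seminorm n (\<lambda>x. c * v x - u x)
            = \<bar>c\<bar> * Cinf_seminorm n (\<lambda>x. v x - inverse c * u x)" if v: "v \<in> Cinf_circle" for v
      proof -
        have "(\<lambda>x. v x + (- inverse c) * u x) \<in> Cinf_circle"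
          by (intro Cinf_circle_add v Cinf_circle_cmult u)
        then have "(\<lambda>x. v x - inverse c * u x) \<in> Cinf_circle" by simp
        from Cinf_seminorm_cmult[OF this c, of n]
        show ?thesis using c by (simp add: right_diff_distrib flip: mult.assoc)
      qed
      then show ?thesis
        using c by (auto simp: Cinf_ball_def Cinf_circle_cmult pos_less_divide_eq mult.commute)
    qed
    moreover have "openin Cinf_topology (Cinf_ball (\<lambda>x. inverse c * u x) n (r / \<bar>c\<bar>))"
      unfolding Cinf_topology_def
      by (rule topology_generated_by_Basis) (use u r c Cinf_circle_cmult in fastforce)
    ultimately show ?thesis by simp
  qed
  moreover have "(\<Union>{Cinf_ball u n r |u n r. u \<in> Cinf_circle \<and> 0 < r}) = Cinf_circle"
    using topspace_Cinf_topology unfolding Cinf_topology_def topology_generated_by_topspace .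
  ultimately show ?thesis
    unfolding Cinf_topology_def[symmetric]
    by (subst (2) Cinf_topology_def, intro continuous_on_generated_topo)
       (auto simp: topspace_Cinf_topology Cinf_circle_cmult)
qed

lemma regular_inertia_operators_cmult:
  assumes A: "A \<in> regular_inertia_operators" and c: "c \<noteq> 0"
  shows "(\<lambda>u x. c * A u x) \<in> regular_inertia_operators"
proof -
  let ?S = "\<lambda>u::real \<Rightarrow> real. \<lambda>x. c * u x"
  have "bij_betw ?S Cinf_circle Cinf_circle"
    by (rule bij_betw_byWitness[where f' = "\<lambda>u x. inverse c * u x"])
       (use c in \<open>auto simp: Cinf_circle_cmult simp flip: mult.assoc\<close>)
  moreover have eq: "(\<lambda>u x. c * A u x) = ?S \<circ> A" by (simp add: comp_def)
  ultimately have "bij_betw (\<lambda>u x. c * A u x) Cinf_circle Cinf_circle"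
    using A bij_betw_trans unfolding eq regular_inertia_operators_def by blast
  moreover have "continuous_map Cinf_topology Cinf_topology (\<lambda>u x. c * A u x)"
    using A continuous_map_cmult[OF c] continuous_map_compose
    unfolding eq regular_inertia_operators_def by blast
  moreover have "L2_inner (\<lambda>x. c * f x) g = c * L2_inner f g"
    "L2_inner f (\<lambda>x. c * g x) = c * L2_inner f g" for f g
    by (simp_all add: L2_inner_def mult.assoc mult.left_commute)
  ultimately show ?thesis
    using A by (simp add: regular_inertia_operators_def algebra_simps)
qed

lemma is_euler_equation_cmult:
  assumes A: "A \<in> regular_inertia_operators" and c: "c \<noteq> 0" and E: "is_euler_equation a b A"
  shows "is_euler_equation a b (\<lambda>u x. c * A u x)"
proof -
  let ?cA = "\<lambda>u x. c * A u x"
  have cA: "?cA \<in> regular_inertia_operators" by (rule regular_inertia_operators_cmult[OF A c])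
  have "euler_bilinear ?cA u u = euler_bilinear A u u" if u: "u \<in> Cinf_circle" for u
  proof -
    let ?w = "\<lambda>y. 2 * A u y * deriv u y + u y * deriv (A u) y"
    have bij: "bij_betw A Cinf_circle Cinf_circle"
      using A by (simp add: regular_inertia_operators_def)
    have w: "?w \<in> Cinf_circle" by (rule euler_rhs_in_Cinf[OF A u])
    have Au: "A u \<in> Cinf_circle" using bij u by (auto simp: bij_betw_def)
    have "deriv (\<lambda>x. c * A u x) = (\<lambda>x. c * deriv (A u) x)"
      using iter_deriv_cmult[OF Au, of 1 c] by simp
    then have rhs: "(\<lambda>y. 2 * ?cA u y * deriv u y + u y * deriv (?cA u) y) = (\<lambda>y. c * ?w y)"
      by (simp add: algebra_simps)
    have v: "op_inverse A ?w \<in> Cinf_circle" "A (op_inverse A ?w) = ?w"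
      using bij w by (auto simp: bij_betw_def inv_into_into f_inv_into_f)
    have "bij_betw ?cA Cinf_circle Cinf_circle"
      using cA by (simp add: regular_inertia_operators_def)
    from bij_betw_inv_into_left[OF this v(1)]
    have "op_inverse ?cA (\<lambda>y. c * ?w y) = op_inverse A ?w"
      using v(2) by simp
    then show ?thesis
      unfolding euler_bilinear_diag[OF cA u] euler_bilinear_diag[OF A u] rhs .
  qed
  then show ?thesis using E by (simp add: is_euler_equation_def)
qed

end

theory Submission
  imports Defs
begin

text \<open>Everything is read off in Fourier modes \<open>e\<^sub>k\<close>; write \<open>\<lambda>\<^sub>k\<close> for the eigenvalues of
  \<open>Lambda_mu a\<close>. The quadratic equation at \<open>u = 1\<close> makes \<open>A 1\<close> a nonzero constant \<open>c\<close>. Polarised at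
  \<open>(1, e\<^sub>k)\<close> it becomes \<open>2 c e\<^sub>k' + (A e\<^sub>k)' = (1 + b / \<lambda>\<^sub>k) A e\<^sub>k'\<close>, which forces \<open>b \<noteq> 0\<close>, gives \<open>A e\<^sub>k\<close>
  the coefficient \<open>2 c \<lambda>\<^sub>k / b\<close> at \<open>k\<close>, and allows one further nonzero coefficient, at \<open>k (1 + b / \<lambda>\<^sub>k)\<close>.
  Comparing coefficients at \<open>2\<close> in the equation at \<open>(e\<^sub>1, e\<^sub>1)\<close> yields \<open>b + 1 = 3\<close>. For \<open>b = 2\<close> the
  further coefficient would sit at a frequency of strictly larger absolute value, which is incompatible
  with the symmetry of \<open>A\<close>. So \<open>A\<close> is diagonal with eigenvalues \<open>c \<lambda>\<^sub>k\<close>, and Fourier inversion for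
  smooth functions extends this from the modes to all of \<open>Cinf_circle\<close>.\<close>

section \<open>Fourier series of smooth functions\<close>

definition fourier_mode :: "int \<Rightarrow> real \<Rightarrow> complex" where
  "fourier_mode k x = cis (2 * pi * of_int k * x)"

lemma fourier_mode_mult: "fourier_mode j x * fourier_mode k x = fourier_mode (j + k) x"
  by (simp add: fourier_mode_def cis_mult algebra_simps)

lemma fourier_mode_0 [simp]: "fourier_mode 0 x = 1"
  by (simp add: fourier_mode_def)

lemma norm_fourier_mode [simp]: "norm (fourier_mode k x) = 1"
  by (simp add: fourier_mode_def)

lemma cnj_fourier_mode [simp]: "cnj (fourier_mode k x) = fourier_mode (- k) x"
  by (simp add: fourier_mode_def cis_cnj)

lemma fourier_mode_add: "fourier_mode k (x + y) = fourier_mode k x * fourier_mode k y"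
  by (simp add: fourier_mode_def cis_mult algebra_simps)

lemma fourier_mode_of_int [simp]: "fourier_mode k (of_int n) = 1"
  using cis_multiple_2pi[of "of_int (k * n)"] by (simp add: fourier_mode_def mult.assoc)

lemma fourier_mode_at_1 [simp]: "fourier_mode k 1 = 1"
  using fourier_mode_of_int[of k 1] by simp

lemma fourier_mode_at_0 [simp]: "fourier_mode k 0 = 1"
  using fourier_mode_of_int[of k 0] by simp

lemma has_vector_derivative_fourier_mode:
  "(fourier_mode k has_vector_derivative 2 * pi * \<i> * of_int k * fourier_mode k x) (at x within S)"
  unfolding fourier_mode_def has_vector_derivative_def
  by (auto intro!: derivative_eq_intros simp: scaleR_conv_of_real algebra_simps)

lemma continuous_on_fourier_mode [continuous_intros]: "continuous_on S (fourier_mode k)"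
  by (rule continuous_on_vector_derivative[OF has_vector_derivative_fourier_mode])

text \<open>Locates the zeros of the denominator \<open>fourier_mode 1 t - 1\<close> used in the
  convergence proof at 0.\<close>

lemma fourier_mode_eq_1_iff: "fourier_mode 1 x = 1 \<longleftrightarrow> x \<in> \<int>"
proof
  assume "fourier_mode 1 x = 1"
  then have "cos (2 * pi * x) = 1" by (simp add: fourier_mode_def complex_eq_iff)
  then obtain n :: int where "2 * pi * x = of_int n * 2 * pi"
    by (auto simp: cos_one_2pi_int)
  then have "x = of_int n" by simp
  then show "x \<in> \<int>" by simp
qed (auto elim!: Ints_cases)

lemma integral_fourier_mode: "integral {0..1} (fourier_mode k) = (if k = 0 then 1 else 0)"
proof (cases "k = 0")
  case False
  define c where "c = 2 * pi * \<i> * of_int k"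
  have c: "c \<noteq> 0" using False by (simp add: c_def)
  have "((\<lambda>x. c * fourier_mode k x) has_integral fourier_mode k 1 - fourier_mode k 0) {0..1}"
    unfolding c_def by (intro fundamental_theorem_of_calculus has_vector_derivative_fourier_mode) simp
  then have "((\<lambda>x. inverse c * (c * fourier_mode k x)) has_integral inverse c * 0) {0..1}"
    by (intro has_integral_mult_right) simp
  then show ?thesis using False c by (simp add: integral_unique flip: mult.assoc)
qed (simp add: fourier_mode_def[abs_def])

section \<open>Coefficients of continuous functions, Bessel, Riemann-Lebesgue\<close>

text \<open>Extends \<open>fourier_coeff\<close> to complex-valued functions, because Bessel's
  inequality will be applied to a quotient with complex denominator.\<close>

definition complex_coeff :: "(real \<Rightarrow> complex) \<Rightarrow> int \<Rightarrow> complex" where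
  "complex_coeff g k = integral {0..1} (\<lambda>x. g x * fourier_mode (- k) x)"

lemma fourier_coeff_eq_complex: "fourier_coeff u k = complex_coeff (\<lambda>x. of_real (u x)) k"
  by (simp add: fourier_coeff_def complex_coeff_def fourier_mode_def)

lemma complex_coeff_integrable:
  "continuous_on {0..1} g \<Longrightarrow> (\<lambda>x. g x * fourier_mode k x) integrable_on {0..1}"
  by (intro integrable_continuous_real continuous_intros)

lemma complex_coeff_sum_modes:
  assumes "finite F"
  shows "complex_coeff (\<lambda>x. \<Sum>j\<in>F. c j * fourier_mode j x) k = (if k \<in> F then c k else 0)"
proof -
  have "complex_coeff (\<lambda>x. \<Sum>j\<in>F. c j * fourier_mode j x) k =
        integral {0..1} (\<lambda>x. \<Sum>j\<in>F. c j * fourier_mode (j - k) x)"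
    by (simp add: complex_coeff_def sum_distrib_right mult.assoc fourier_mode_mult)
  also have "\<dots> = (\<Sum>j\<in>F. c j * integral {0..1} (fourier_mode (j - k)))"
    using assms by (subst integral_sum) (auto intro!: integrable_continuous_real continuous_intros)
  also have "\<dots> = (\<Sum>j\<in>F. if j = k then c k else 0)"
    by (intro sum.cong) (auto simp: integral_fourier_mode)
  also have "\<dots> = (if k \<in> F then c k else 0)"
    using assms by simp
  finally show ?thesis .
qed

text \<open>With \<open>s\<close> the partial sum of \<open>g\<close> over \<open>F\<close>, the
  integral of the square of \<open>norm (g x - s x)\<close> equals the integral for \<open>g\<close>
  minus the sum of squared coefficients, and it is nonnegative.\<close>

lemma Bessel_inequality:
  assumes g: "continuous_on {0..1} g" and F: "finite F"
  shows "(\<Sum>k\<in>F. (norm (complex_coeff g k))\<^sup>2) \<le> integral {0..1} (\<lambda>x. (norm (g x))\<^sup>2)"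
proof -
  define c where "c = complex_coeff g"
  define s where "s = (\<lambda>x. \<Sum>k\<in>F. c k * fourier_mode k x)"
  have s: "continuous_on {0..1} s" unfolding s_def by (intro continuous_intros)
  \<comment> \<open>Used for both \<open>h = g\<close> and \<open>h = s\<close>: the two pairings
    with \<open>s\<close> give the same real number \<open>T\<close>, so the expansion of the square
    collapses.\<close>
  have gs: "integral {0..1} (\<lambda>x. h x * cnj (s x)) = (\<Sum>k\<in>F. cnj (c k) * complex_coeff h k)"
    if h: "continuous_on {0..1} h" for h
  proof -
    have "integral {0..1} (\<lambda>x. h x * cnj (s x)) =
          integral {0..1} (\<lambda>x. \<Sum>k\<in>F. cnj (c k) * (h x * fourier_mode (- k) x))"
      by (simp add: s_def sum_distrib_left mult_ac)
    also have "\<dots> = (\<Sum>k\<in>F. cnj (c k) * complex_coeff h k)"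
      unfolding complex_coeff_def using F
      by (subst integral_sum) (auto intro!: integrable_continuous_real continuous_intros h)
    finally show ?thesis .
  qed
  have ss: "complex_coeff s k = (if k \<in> F then c k else 0)" for k
    unfolding s_def by (rule complex_coeff_sum_modes[OF F])
  define T where "T = (\<Sum>k\<in>F. (norm (c k))\<^sup>2)"
  have T1: "integral {0..1} (\<lambda>x. g x * cnj (s x)) = of_real T"
    unfolding gs[OF g] T_def c_def[symmetric] of_real_sum
    by (intro sum.cong refl) (simp only: complex_norm_square mult.commute)
  have T2: "integral {0..1} (\<lambda>x. s x * cnj (s x)) = of_real T"
    unfolding gs[OF s] T_def ss of_real_sum
    by (intro sum.cong refl) (simp add: complex_norm_square mult.commute del: of_real_power)
  have i1: "(\<lambda>x. g x * cnj (s x)) integrable_on {0..1}"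
    by (intro integrable_continuous_real continuous_intros g s)
  have i2: "(\<lambda>x. s x * cnj (s x)) integrable_on {0..1}"
    by (intro integrable_continuous_real continuous_intros g s)
  have R1: "((\<lambda>x. Re (g x * cnj (s x))) has_integral T) {0..1}"
    using has_integral_Re[OF integrable_integral[OF i1]] T1 by simp
  have R2: "((\<lambda>x. Re (s x * cnj (s x))) has_integral T) {0..1}"
    using has_integral_Re[OF integrable_integral[OF i2]] T2 by simp
  have R0: "((\<lambda>x. (norm (g x))\<^sup>2) has_integral integral {0..1} (\<lambda>x. (norm (g x))\<^sup>2)) {0..1}"
    by (intro integrable_integral integrable_continuous_real continuous_intros g)
  have "((\<lambda>x. (norm (g x))\<^sup>2 - 2 * Re (g x * cnj (s x)) + Re (s x * cnj (s x)))
           has_integral integral {0..1} (\<lambda>x. (norm (g x))\<^sup>2) - 2 * T + T) {0..1}"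
    by (intro has_integral_add has_integral_diff has_integral_mult_right R0 R1 R2)
  moreover have "(norm (g x))\<^sup>2 - 2 * Re (g x * cnj (s x)) + Re (s x * cnj (s x))
      = (norm (g x - s x))\<^sup>2" for x
    by (simp only: cmod_power2) (simp add: power2_eq_square algebra_simps)
  ultimately have "((\<lambda>x. (norm (g x - s x))\<^sup>2) has_integral
      integral {0..1} (\<lambda>x. (norm (g x))\<^sup>2) - T) {0..1}" by simp
  from has_integral_nonneg[OF this] show ?thesis by (simp add: T_def c_def)
qed

text \<open>Bessel bounds the partial sums of the squared coefficients along \<open>h\<close>, so
  that series converges and its terms tend to 0. Injectivity of \<open>h\<close> turns each partial
  sum into a sum over a set of frequencies.\<close>

lemma Riemann_Lebesgue:
  assumes g: "continuous_on {0..1} g" and h: "inj (h :: nat \<Rightarrow> int)"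
  shows "(\<lambda>n. complex_coeff g (h n)) \<longlonglongrightarrow> 0"
proof -
  have "summable (\<lambda>n. (norm (complex_coeff g (h n)))\<^sup>2)"
  proof (rule summableI_nonneg_bounded)
    fix n
    have "(\<Sum>i<n. (norm (complex_coeff g (h i)))\<^sup>2) = (\<Sum>k\<in>h ` {..<n}. (norm (complex_coeff g k))\<^sup>2)"
      using h by (subst sum.reindex) (auto simp: inj_def inj_on_def)
    then show "(\<Sum>i<n. (norm (complex_coeff g (h i)))\<^sup>2) \<le> integral {0..1} (\<lambda>x. (norm (g x))\<^sup>2)"
      using Bessel_inequality[OF g, of "h ` {..<n}"] by simp
  qed simp
  from summable_LIMSEQ_zero[OF this] show ?thesis
    by (simp add: tendsto_norm_zero_iff)
qed

subsection \<open>Calculus on the circle\<close>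

lemma Cinf_circle_has_derivative:
  assumes "u \<in> Cinf_circle"
  shows "(u has_field_derivative deriv u x) (at x within S)"
  using assms[unfolded Cinf_circle_def] DERIV_deriv_iff_field_differentiable[of u x]
  by (metis (mono_tags, lifting) funpow_0 mem_Collect_eq has_field_derivative_at_within)

lemma Cinf_circle_continuous [continuous_intros]: "u \<in> Cinf_circle \<Longrightarrow> continuous_on S u"
  by (meson Cinf_circle_has_derivative DERIV_continuous_on)

lemma Cinf_circle_periodic: "u \<in> Cinf_circle \<Longrightarrow> u (x + 1) = u x"
  by (simp add: Cinf_circle_def)

lemma Cinf_circle_has_vector_derivative:
  assumes "u \<in> Cinf_circle"
  shows "((\<lambda>x. of_real (u x) :: complex) has_vector_derivative of_real (deriv u x)) (at x within S)"
  using Cinf_circle_has_derivative[OF assms]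
  by (intro has_vector_derivative_of_real) (simp add: has_real_derivative_iff_has_vector_derivative)

text \<open>Translations reduce convergence of the Fourier series at any point to convergence at
  0.\<close>

lemma Cinf_circle_shift:
  assumes u: "u \<in> Cinf_circle"
  shows "(\<lambda>t. u (t + a)) \<in> Cinf_circle"
proof -
  have d: "(deriv ^^ n) u field_differentiable (at x)" for n x
    using u by (simp add: Cinf_circle_def)
  have eq: "(deriv ^^ n) (\<lambda>t. u (t + a)) = (\<lambda>t. (deriv ^^ n) u (t + a))" for n
  proof (induction n)
    case (Suc n)
    have "((\<lambda>t. (deriv ^^ n) u (t + a)) has_field_derivative (deriv ^^ Suc n) u (x + a)) (at x)" for x
      using d[of n "x + a"] DERIV_deriv_iff_field_differentiable[of "(deriv ^^ n) u" "x + a"]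
      by (simp add: DERIV_shift)
    then show ?case by (auto simp: Suc intro!: DERIV_imp_deriv)
  qed simp
  have "(\<lambda>t. (deriv ^^ n) u (t + a)) field_differentiable (at x)" for n x
    using d[of n "x + a"] unfolding field_differentiable_def by (simp add: DERIV_shift)
  moreover have "u (x + 1 + a) = u (x + a)" for x
    using Cinf_circle_periodic[OF u, of "x + a"] by (simp add: algebra_simps)
  ultimately show ?thesis by (simp add: Cinf_circle_def eq)
qed

text \<open>With \<open>H\<close> a primitive of \<open>h\<close>, the shifted integral is
  \<open>H (1 + s) - H s\<close>. Its derivative \<open>h (1 + s) - h s\<close> vanishes by
  periodicity, so it does not depend on \<open>s\<close>.\<close>

lemma integral_periodic_shift:
  fixes h :: "real \<Rightarrow> complex"
  assumes h: "continuous_on UNIV h" and per: "\<And>x. h (x + 1) = h x"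
  shows "integral {0..1} (\<lambda>t. h (t + a)) = integral {0..1} h"
proof -
  \<comment> \<open>Large enough that \<open>s\<close>, \<open>1 + s\<close> and
    \<open>t + s\<close> lie strictly inside the interval of the primitive whenever \<open>s\<close>
    is at most \<open>\<bar>a\<bar>\<close> in absolute value and \<open>t\<close> is in
    \<open>{0..1}\<close>.\<close>
  define R where "R = \<bar>a\<bar> + 2"
  define H where "H = (\<lambda>x. integral {-R..x} h)"
  have cont: "continuous_on S h" for S using h continuous_on_subset by blast
  have H: "(H has_vector_derivative h x) (at x)" if "x \<in> {-R<..<R}" for x
    using integral_has_vector_derivative[OF cont[of "{-R..R}"], of x] that
    by (auto simp: H_def at_within_Icc_at)
  define D where "D = (\<lambda>s. H (1 + s) - H s)"
  have D: "(D has_vector_derivative 0) (at s within {- \<bar>a\<bar>..\<bar>a\<bar>})" if "s \<in> {- \<bar>a\<bar>..\<bar>a\<bar>}" for s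
  proof -
    have Hs: "(H has_vector_derivative h s) (at s)"
      and H1: "(H has_vector_derivative h (1 + s)) (at (1 + s))"
      using that by (auto intro!: H simp: R_def)
    have "((\<lambda>s. 1 + s) has_vector_derivative 1) (at s)"
      by (auto intro!: derivative_eq_intros)
    from vector_diff_chain_at[OF this H1]
    have "((\<lambda>s. H (1 + s)) has_vector_derivative h (1 + s)) (at s)"
      by (simp add: comp_def)
    from has_vector_derivative_diff[OF this Hs]
    have "((\<lambda>s. H (1 + s) - H s) has_vector_derivative h (1 + s) - h s) (at s)" .
    then have "((\<lambda>s. H (1 + s) - H s) has_vector_derivative 0) (at s)"
      using per[of s] by (metis add.commute diff_self)
    then show ?thesis unfolding D_def by (rule has_vector_derivative_at_within)
  qed
  have int: "integral {0..1} (\<lambda>t. h (t + s)) = D s" if s: "s \<in> {- \<bar>a\<bar>..\<bar>a\<bar>}" for s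
  proof -
    have "((\<lambda>t. H (t + s)) has_vector_derivative h (t + s)) (at t within {0..1})" if "t \<in> {0..1}" for t
    proof -
      have Hts: "(H has_vector_derivative h (t + s)) (at (t + s))"
        using s that by (intro H) (auto simp: R_def)
      have "((\<lambda>t. t + s) has_vector_derivative 1) (at t)"
        by (auto intro!: derivative_eq_intros)
      from vector_diff_chain_at[OF this Hts]
      have "((H \<circ> (\<lambda>t. t + s)) has_vector_derivative h (t + s)) (at t)"
        by simp
      then show ?thesis
        by (simp add: comp_def has_vector_derivative_at_within)
    qed
    then have "((\<lambda>t. h (t + s)) has_integral H (1 + s) - H (0 + s)) {0..1}"
      by (intro fundamental_theorem_of_calculus) auto
    then show ?thesis by (simp add: D_def integral_unique)
  qed
  obtain c where c: "\<And>s. s \<in> {- \<bar>a\<bar>..\<bar>a\<bar>} \<Longrightarrow> D s = c"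
    by (rule has_vector_derivative_zero_constant[OF _ D]) auto
  have mem: "a \<in> {- \<bar>a\<bar>..\<bar>a\<bar>}" "0 \<in> {- \<bar>a\<bar>..\<bar>a\<bar>}" by auto
  then have "D a = D 0" using c by metis
  then show ?thesis using int[OF mem(1)] int[OF mem(2)] by simp
qed

lemma fourier_coeff_shift:
  assumes u: "u \<in> Cinf_circle"
  shows "fourier_coeff (\<lambda>t. u (t + a)) k = fourier_coeff u k * fourier_mode k a"
proof -
  define h where "h = (\<lambda>x. of_real (u x) * fourier_mode (- k) x)"
  have "continuous_on UNIV h" unfolding h_def by (intro continuous_intros u)
  moreover have "h (x + 1) = h x" for x
    by (simp add: h_def Cinf_circle_periodic[OF u] fourier_mode_add)
  ultimately have "integral {0..1} (\<lambda>t. h (t + a)) = integral {0..1} h"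
    by (rule integral_periodic_shift)
  moreover have "of_real (u (t + a)) * fourier_mode (- k) t = fourier_mode k a * h (t + a)" for t
  proof -
    have "fourier_mode k a * fourier_mode (- k) a = 1" by (simp add: fourier_mode_mult)
    then show ?thesis by (simp add: h_def fourier_mode_add)
  qed
  ultimately have "integral {0..1} (\<lambda>t. of_real (u (t + a)) * fourier_mode (- k) t) =
      fourier_mode k a * integral {0..1} h"
    by (simp only: integral_mult_right)
  then show ?thesis
    by (simp add: fourier_coeff_eq_complex complex_coeff_def h_def)
qed

section \<open>Convergence of the partial sums at 0\<close>

lemma complex_coeff_one: "complex_coeff (\<lambda>x. c) k = (if k = 0 then c else 0)"
  using complex_coeff_sum_modes[of "{0}" "\<lambda>_. c" k] by simp

lemma symmetric_partial_sum_telescope: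
  fixes d :: "int \<Rightarrow> 'a :: ab_group_add"
  shows "(\<Sum>k\<in>{- int n..int n}. d (k - 1) - d k) = d (- 1 - int n) - d (int n)"
proof (induction n)
  case (Suc n)
  have "{- int (Suc n)..int (Suc n)} = insert (- int (Suc n)) (insert (int (Suc n)) {- int n..int n})"
    by auto
  then show ?case using Suc by (simp add: algebra_simps)
qed simp

text \<open>Chernoff's argument: dividing \<open>u - u 0\<close> by \<open>fourier_mode 1 - 1\<close> leaves a continuous function,
  and in terms of its coefficients the partial sums at \<open>0\<close> telescope.\<close>

lemma fourier_partial_sums_at_0:
  assumes u: "u \<in> Cinf_circle"
  shows "(\<lambda>n. \<Sum>k\<in>{- int n..int n}. fourier_coeff u k) \<longlonglongrightarrow> of_real (u 0)"
proof -
  define q where "q = (\<lambda>t. of_real (u t - u 0) / (fourier_mode 1 t - 1))"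
  \<comment> \<open>The value at integers is the limit of \<open>q\<close> there: numerator and
    denominator both vanish, with derivatives \<open>deriv u 0\<close> and
    \<open>2 * pi * \<i>\<close>.\<close>
  define g where "g = (\<lambda>t. if t \<in> \<int> then of_real (deriv u 0) / (2 * pi * \<i>) else q t)"
  have per: "u a = u 0" "deriv u a = deriv u 0" if "a = 0 \<or> a = 1" for a
    using that Cinf_circle_periodic[OF u, of 0] Cinf_circle_periodic[OF Cinf_circle_deriv[OF u], of 0]
    by auto
  have lim: "(q \<longlongrightarrow> of_real (deriv u 0) / (2 * pi * \<i>)) (at a)" if a: "a = 0 \<or> a = 1" for a :: real
  proof -
    have "((\<lambda>t. (u t - u a) / (t - a)) \<longlongrightarrow> deriv u a) (at a)"
      using Cinf_circle_has_derivative[OF u] has_field_derivative_iff by blast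
    then have 1: "((\<lambda>t. complex_of_real ((u t - u 0) / (t - a))) \<longlongrightarrow> of_real (deriv u 0)) (at a)"
      using per[OF a] by (simp only: tendsto_of_real_iff)
    have "((\<lambda>z. exp (2 * pi * \<i> * z)) has_field_derivative 2 * pi * \<i> * exp (2 * pi * \<i> * of_real a))
            (at (of_real a))"
      by (auto intro!: derivative_eq_intros)
    moreover have e: "exp (2 * pi * \<i> * of_real t) = fourier_mode 1 t" for t
      by (simp add: fourier_mode_def cis_conv_exp mult_ac)
    moreover have ea: "fourier_mode 1 a = 1" using a by auto
    ultimately have "((\<lambda>z. (exp (2 * pi * \<i> * z) - 1) / (z - of_real a)) \<longlongrightarrow> 2 * pi * \<i>) (at (of_real a))"
      by (simp add: has_field_derivative_iff)
    \<comment> \<open>Restricts the complex difference quotient of \<open>exp\<close> to the real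
      line.\<close>
    moreover have "filterlim complex_of_real (at (of_real a)) (at a)"
      unfolding filterlim_at by (auto intro!: tendsto_intros simp: eventually_at_filter)
    ultimately have "((\<lambda>t. (exp (2 * pi * \<i> * of_real t) - 1) / (of_real t - of_real a)) \<longlongrightarrow> 2 * pi * \<i>) (at a)"
      by (rule filterlim_compose)
    then have 2: "((\<lambda>t. (fourier_mode 1 t - 1) / (of_real t - of_real a)) \<longlongrightarrow> 2 * pi * \<i>) (at a)"
      by (simp only: e)
    have "((\<lambda>t. complex_of_real ((u t - u 0) / (t - a)) / ((fourier_mode 1 t - 1) / (of_real t - of_real a)))
        \<longlongrightarrow> of_real (deriv u 0) / (2 * pi * \<i>)) (at a)"
      by (rule tendsto_divide[OF 1 2]) simp
    moreover have "\<forall>\<^sub>F t in at a. complex_of_real ((u t - u 0) / (t - a)) /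
          ((fourier_mode 1 t - 1) / (of_real t - of_real a)) = q t"
      unfolding eventually_at_filter by (simp add: q_def)
    ultimately show ?thesis by (rule Lim_transform_eventually)
  qed
  \<comment> \<open>A neighbourhood of \<open>{0..1}\<close> whose only integers are 0 and 1, so
    that \<open>g\<close> is continuous from both sides at the end points as well.\<close>
  have Ints: "t \<in> \<int> \<longleftrightarrow> t = 0 \<or> t = 1" if "t \<in> {-1<..<2}" for t :: real
    using that by (auto elim!: Ints_cases)
  have "isCont g t" if t: "t \<in> {0..1}" for t
  proof (cases "t = 0 \<or> t = 1")
    case True
    have "\<forall>\<^sub>F s in at t. s \<in> {-1<..<2}"
      using t by (intro eventually_at_in_open') auto
    moreover have "\<forall>\<^sub>F s in at t. s \<noteq> 0 \<and> s \<noteq> 1"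
      using eventually_neq_at_within[of 0 t UNIV] eventually_neq_at_within[of 1 t UNIV]
      by (rule eventually_conj)
    ultimately have "\<forall>\<^sub>F s in at t. q s = g s"
    proof eventually_elim
      case (elim s)
      then show ?case using Ints[of s] by (simp add: g_def)
    qed
    from Lim_transform_eventually[OF lim[OF True] this] show ?thesis
      using True unfolding isCont_def by (auto simp: g_def)
  next
    case False
    then have t': "t \<in> {0<..<1}" using t by auto
    have ne: "fourier_mode 1 s - 1 \<noteq> 0" if "s \<in> {0<..<1}" for s
      using that Ints[of s] by (simp add: fourier_mode_eq_1_iff)
    have "continuous_on {0<..<1} q"
      unfolding q_def by (intro continuous_intros u) (use ne in auto)
    moreover have "g s = q s" if "s \<in> {0<..<1}" for s
      using that Ints[of s] by (simp add: g_def)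
    ultimately have "continuous_on {0<..<1} g"
      by (metis (no_types, lifting) continuous_on_cong)
    then show ?thesis using t' by (simp add: continuous_on_eq_continuous_at)
  qed
  then have g: "continuous_on {0..1} g" by (rule continuous_at_imp_continuous_on[rule_format])
  \<comment> \<open>Holds at the end points too, where both sides are 0.\<close>
  have num: "of_real (u t) - of_real (u 0) = g t * fourier_mode 1 t - g t" if "t \<in> {0..1}" for t
    using that Ints[of t] per[of 1] fourier_mode_eq_1_iff[of t]
    by (auto simp: g_def q_def field_simps)
  \<comment> \<open>Multiplication by \<open>fourier_mode 1\<close> shifts coefficients by one, so
    those of \<open>u - u 0\<close> are differences of consecutive coefficients of
    \<open>g\<close>.\<close>
  have "fourier_coeff u k = (if k = 0 then of_real (u 0) else 0) + (complex_coeff g (k - 1) - complex_coeff g k)"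
    for k
  proof -
    have "fourier_coeff u k - complex_coeff (\<lambda>x. of_real (u 0)) k
        = integral {0..1} (\<lambda>x. of_real (u x) * fourier_mode (- k) x - of_real (u 0) * fourier_mode (- k) x)"
      unfolding fourier_coeff_eq_complex complex_coeff_def
      by (intro integral_diff[symmetric] complex_coeff_integrable continuous_intros u)
    also have "\<dots> = integral {0..1} (\<lambda>x. g x * fourier_mode (- (k - 1)) x - g x * fourier_mode (- k) x)"
    proof (rule integral_cong)
      fix x :: real assume "x \<in> {0..1}"
      from num[OF this] have "(of_real (u x) - of_real (u 0)) * fourier_mode (- k) x
           = (g x * fourier_mode 1 x - g x) * fourier_mode (- k) x" by simp
      then show "of_real (u x) * fourier_mode (- k) x - of_real (u 0) * fourier_mode (- k) x
           = g x * fourier_mode (- (k - 1)) x - g x * fourier_mode (- k) x"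
        by (simp add: algebra_simps fourier_mode_mult)
    qed
    also have "\<dots> = complex_coeff g (k - 1) - complex_coeff g k"
      unfolding complex_coeff_def by (intro integral_diff complex_coeff_integrable g)
    finally show ?thesis by (simp add: complex_coeff_one algebra_simps)
  qed
  then have "(\<Sum>k\<in>{- int n..int n}. fourier_coeff u k) =
      of_real (u 0) + (complex_coeff g (- 1 - int n) - complex_coeff g (int n))" for n
    by (simp add: sum.distrib symmetric_partial_sum_telescope)
  moreover have "(\<lambda>n. complex_coeff g (- 1 - int n)) \<longlonglongrightarrow> 0" "(\<lambda>n. complex_coeff g (int n)) \<longlonglongrightarrow> 0"
    by (intro Riemann_Lebesgue g; simp add: inj_def)+
  ultimately show ?thesis by (auto intro!: tendsto_eq_intros)
qed

section \<open>Rules for Fourier coefficients and their decay\<close>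

lemma fourier_coeff_integrable:
  "u \<in> Cinf_circle \<Longrightarrow> (\<lambda>x. of_real (u x) * fourier_mode k x) integrable_on {0..1}"
  by (intro complex_coeff_integrable continuous_intros)

lemma fourier_coeff_alt:
  "fourier_coeff u k = integral {0..1} (\<lambda>x. of_real (u x) * fourier_mode (- k) x)"
  by (simp add: fourier_coeff_eq_complex complex_coeff_def)

lemma fourier_coeff_add:
  assumes "u \<in> Cinf_circle" "v \<in> Cinf_circle"
  shows "fourier_coeff (\<lambda>x. u x + v x) k = fourier_coeff u k + fourier_coeff v k"
  unfolding fourier_coeff_alt of_real_add distrib_right
  by (intro integral_add fourier_coeff_integrable assms)

lemma fourier_coeff_cmult: "fourier_coeff (\<lambda>x. c * u x) k = of_real c * fourier_coeff u k"
  unfolding fourier_coeff_alt of_real_mult mult.assoc by (rule integral_mult_right)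

lemma fourier_coeff_0: "fourier_coeff u 0 = of_real (mean u)" if "u \<in> Cinf_circle"
  unfolding fourier_coeff_alt mean_def
  using that by (simp add: integral_unique integrable_integral integrable_continuous_real
      Cinf_circle_continuous has_integral_of_real)

lemma fourier_coeff_minus: "fourier_coeff u (- k) = cnj (fourier_coeff u k)"
  unfolding fourier_coeff_alt by (subst integral_cnj) simp

text \<open>Integration by parts; the boundary terms cancel by periodicity.\<close>

lemma fourier_coeff_deriv:
  assumes u: "u \<in> Cinf_circle"
  shows "fourier_coeff (deriv u) k = 2 * pi * \<i> * of_int k * fourier_coeff u k"
proof -
  define c where "c = 2 * pi * \<i> * of_int k"
  have "((\<lambda>x. of_real (u x) * fourier_mode (- k) x) has_vector_derivative
      of_real (u x) * (- c * fourier_mode (- k) x) + of_real (deriv u x) * fourier_mode (- k) x)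
      (at x within {0..1})" for x
    using has_vector_derivative_mult[OF Cinf_circle_has_vector_derivative[OF u]
        has_vector_derivative_fourier_mode[of "- k"]]
    by (simp add: c_def)
  then have "((\<lambda>x. of_real (u x) * (- c * fourier_mode (- k) x) + of_real (deriv u x) * fourier_mode (- k) x)
      has_integral of_real (u 1) * fourier_mode (- k) 1 - of_real (u 0) * fourier_mode (- k) 0) {0..1}"
    by (intro fundamental_theorem_of_calculus) auto
  then have 1: "((\<lambda>x. of_real (u x) * (- c * fourier_mode (- k) x) + of_real (deriv u x) * fourier_mode (- k) x)
      has_integral 0) {0..1}"
    using Cinf_circle_periodic[OF u, of 0] by simp
  have 2: "((\<lambda>x. c * (of_real (u x) * fourier_mode (- k) x)) has_integral c * fourier_coeff u k) {0..1}"
    unfolding fourier_coeff_alt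
    by (intro has_integral_mult_right integrable_integral fourier_coeff_integrable u)
  from has_integral_add[OF 1 2] show ?thesis
    unfolding fourier_coeff_alt[of "deriv u"] c_def[symmetric]
    by (intro integral_unique) (simp add: algebra_simps)
qed

text \<open>Each derivative contributes one factor \<open>k\<close> to the coefficient, so the bound
  of order \<open>Suc n\<close> for \<open>u\<close> follows from that of order \<open>n\<close> for
  \<open>deriv u\<close>. The base case is the \<open>L1\<close> bound.\<close>

lemma fourier_coeff_decay:
  "u \<in> Cinf_circle \<Longrightarrow> \<exists>B. \<forall>k. \<bar>of_int k\<bar> ^ n * norm (fourier_coeff u k) \<le> B"
proof (induction n arbitrary: u)
  case 0
  have "norm (fourier_coeff u k) \<le> integral {0..1} (\<lambda>x. \<bar>u x\<bar>)" for k
    unfolding fourier_coeff_alt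
  proof (rule integral_norm_bound_integral)
    show "(\<lambda>x. \<bar>u x\<bar>) integrable_on {0..1}"
      using 0 by (intro integrable_continuous_real continuous_on_rabs Cinf_circle_continuous)
  qed (use 0 in \<open>simp_all add: fourier_coeff_integrable norm_mult\<close>)
  then show ?case by auto
next
  case (Suc n)
  from Suc.IH[OF Cinf_circle_deriv[OF Suc.prems]]
  obtain B where B: "\<bar>of_int k\<bar> ^ n * norm (fourier_coeff (deriv u) k) \<le> B" for k by blast
  have "\<bar>of_int k\<bar> ^ Suc n * norm (fourier_coeff u k) \<le> B / (2 * pi)" for k :: int
    using B[of k] by (simp add: fourier_coeff_deriv[OF Suc.prems] norm_mult field_simps)
  then show ?case by blast
qed

text \<open>Splits the integers into nonnegative and negative ones. The term at 0 is harmless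
  because \<open>0 powr - 2 = 0\<close>.\<close>

lemma summable_on_int_powr: "(\<lambda>k::int. \<bar>of_int k\<bar> powr - 2 :: real) summable_on UNIV"
proof -
  have s: "summable (\<lambda>n. real n powr - 2)" by (subst summable_real_powr_iff) simp
  have 1: "(\<lambda>n. real n powr - 2) summable_on UNIV"
    by (rule norm_summable_imp_summable_on) (use s in simp)
  have 2: "(\<lambda>n. real (Suc n) powr - 2) summable_on UNIV"
    by (rule norm_summable_imp_summable_on) (use s in \<open>simp add: summable_Suc_iff[of "\<lambda>n. real n powr - 2"] del: of_nat_Suc\<close>)
  have "(\<lambda>k::int. \<bar>of_int k\<bar> powr - 2 :: real) summable_on range int"
    using 1 by (subst summable_on_reindex) (auto simp: comp_def)
  moreover have "(\<lambda>k::int. \<bar>of_int k\<bar> powr - 2 :: real) summable_on range (\<lambda>n. - int (Suc n))"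
    using 2 by (subst summable_on_reindex) (auto simp: comp_def inj_def add.commute)
  moreover have "range int \<inter> range (\<lambda>n. - int (Suc n)) = {}" by auto
  ultimately have "(\<lambda>k::int. \<bar>of_int k\<bar> powr - 2 :: real) summable_on range int \<union> range (\<lambda>n. - int (Suc n))"
    by (rule summable_on_Un_disjoint)
  moreover have "range int \<union> range (\<lambda>n. - int (Suc n)) = UNIV"
  proof -
    have "k \<in> range int \<union> range (\<lambda>n. - int (Suc n))" for k by (cases k rule: int_cases) blast+
    then show ?thesis by blast
  qed
  ultimately show ?thesis by simp
qed

text \<open>Decay of an integer order \<open>n\<close> above \<open>a + 2\<close> leaves the
  summable majorant \<open>\<bar>k\<bar> powr - 2\<close>; at \<open>k = 0\<close> both sides of the
  comparison are 0.\<close>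

lemma fourier_coeff_powr_summable:
  assumes u: "u \<in> Cinf_circle"
  shows "(\<lambda>k. \<bar>of_int k\<bar> powr a * norm (fourier_coeff u k)) summable_on UNIV"
proof -
  define n where "n = nat \<lceil>\<bar>a\<bar> + 2\<rceil>"
  have n: "a + 2 \<le> n" unfolding n_def by linarith
  obtain B where B: "\<And>k. \<bar>of_int k\<bar> ^ n * norm (fourier_coeff u k) \<le> B"
    using fourier_coeff_decay[OF u] by blast
  have "(\<lambda>k::int. B * \<bar>of_int k\<bar> powr - 2) summable_on UNIV"
    by (intro summable_on_cmult_right summable_on_int_powr)
  then show ?thesis
  proof (rule summable_on_comparison_test)
    fix k :: int
    show "\<bar>of_int k\<bar> powr a * norm (fourier_coeff u k) \<le> B * \<bar>of_int k\<bar> powr - 2"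
    proof (cases "k = 0")
      case False
      then have k: "\<bar>of_int k :: real\<bar> \<ge> 1" by linarith
      have "\<bar>of_int k\<bar> powr a = \<bar>of_int k\<bar> powr (a + 2) * \<bar>real_of_int k\<bar> powr - 2"
        by (simp flip: powr_add)
      also have "\<dots> \<le> \<bar>of_int k\<bar> powr n * \<bar>real_of_int k\<bar> powr - 2"
        using k n by (intro mult_right_mono powr_mono) auto
      also have "\<dots> = \<bar>of_int k\<bar> ^ n * \<bar>real_of_int k\<bar> powr - 2"
        using k by (simp add: powr_realpow)
      finally have "\<bar>of_int k\<bar> powr a * norm (fourier_coeff u k)
          \<le> (\<bar>of_int k\<bar> ^ n * \<bar>real_of_int k\<bar> powr - 2) * norm (fourier_coeff u k)"
        by (rule mult_right_mono) simp
      also have "\<dots> = (\<bar>of_int k\<bar> ^ n * norm (fourier_coeff u k)) * \<bar>real_of_int k\<bar> powr - 2"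
        by (simp add: mult_ac)
      also have "\<dots> \<le> B * \<bar>of_int k\<bar> powr - 2"
        by (intro mult_right_mono B) simp
      finally show ?thesis .
    qed simp
  qed simp
qed

text \<open>The value at \<open>k = 0\<close> comes from the summand \<open>mean\<close>.\<close>

definition Lambda_symbol :: "real \<Rightarrow> int \<Rightarrow> real" where
  "Lambda_symbol a k = (if k = 0 then 1 else \<bar>of_int k\<bar> powr a)"

lemma Lambda_symbol_pos: "0 < Lambda_symbol a k"
  by (simp add: Lambda_symbol_def)

lemma Lambda_symbol_neq_0 [simp]: "Lambda_symbol a k \<noteq> 0"
  using Lambda_symbol_pos[of a k] by simp

lemma Lambda_symbol_minus [simp]: "Lambda_symbol a (- k) = Lambda_symbol a k"
  by (simp add: Lambda_symbol_def)

lemma Lambda_symbol_0 [simp]: "Lambda_symbol a 0 = 1"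
  by (simp add: Lambda_symbol_def)

lemma Lambda_symbol_1 [simp]: "Lambda_symbol a 1 = 1"
  by (simp add: Lambda_symbol_def)

lemma Lambda_symbol_order_0 [simp]: "Lambda_symbol 0 k = 1"
  by (simp add: Lambda_symbol_def)

lemma Lambda_symbol_summable:
  assumes u: "u \<in> Cinf_circle"
  shows "(\<lambda>k. Lambda_symbol a k * norm (fourier_coeff u k)) summable_on UNIV"
proof -
  \<comment> \<open>Since \<open>0 powr a = 0\<close>, the summand at 0 is absent from the previous
    series and is supplied here.\<close>
  have "(\<lambda>k. if k = 0 then norm (fourier_coeff u 0) else 0) summable_on (UNIV :: int set)"
    by (rule summable_on_cong_neutral[THEN iffD2, OF _ _ _ summable_on_finite[of "{0}"]]) auto
  from summable_on_add[OF fourier_coeff_powr_summable[OF u, of a] this]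
  show ?thesis
    by (rule summable_on_cong[THEN iffD1, rotated]) (simp add: Lambda_symbol_def)
qed

lemma Lambda_series_summable:
  assumes u: "u \<in> Cinf_circle"
  shows "(\<lambda>k. of_real (Lambda_symbol a k) * fourier_coeff u k * fourier_mode k x) summable_on UNIV"
proof (rule abs_summable_summable)
  show "(\<lambda>k. norm (of_real (Lambda_symbol a k) * fourier_coeff u k * fourier_mode k x)) summable_on UNIV"
    using Lambda_symbol_summable[OF u, of a]
    by (simp add: norm_mult less_imp_le[OF Lambda_symbol_pos])
qed

section \<open>Fourier inversion and the series of \<open>Lambda_mu\<close>\<close>

text \<open>Relates unordered sums over the integers to the symmetric partial sums whose limit is
  known.\<close>

lemma filterlim_symmetric_intervals:
  "filterlim (\<lambda>n. {- int n..int n}) (finite_subsets_at_top UNIV) at_top"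
  unfolding filterlim_finite_subsets_at_top
proof (intro allI impI)
  fix X :: "int set" assume "finite X \<and> X \<subseteq> UNIV"
  then have "finite ((\<lambda>k. nat \<bar>k\<bar>) ` X)" by simp
  then obtain N where N: "\<And>k. k \<in> X \<Longrightarrow> nat \<bar>k\<bar> \<le> N"
    by (meson finite_nat_set_iff_bounded_le imageI)
  show "\<forall>\<^sub>F n in at_top. finite {- int n..int n} \<and> X \<subseteq> {- int n..int n} \<and> {- int n..int n} \<subseteq> UNIV"
    using eventually_ge_at_top[of N] by eventually_elim (use N in force)
qed

text \<open>Absolute convergence gives an unordered sum, which is the limit of the symmetric partial
  sums. At \<open>x\<close> these are the partial sums at 0 of the function shifted by
  \<open>x\<close>, hence tend to \<open>u x\<close>.\<close>

theorem Fourier_inversion: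
  assumes u: "u \<in> Cinf_circle"
  shows "((\<lambda>k. fourier_coeff u k * fourier_mode k x) has_sum of_real (u x)) UNIV"
proof -
  define S where "S = (\<Sum>\<^sub>\<infinity>k. fourier_coeff u k * fourier_mode k x)"
  have S: "((\<lambda>k. fourier_coeff u k * fourier_mode k x) has_sum S) UNIV"
    unfolding S_def using Lambda_series_summable[OF u, of 0 x] by (intro has_sum_infsum) simp
  then have "(\<lambda>n. \<Sum>k\<in>{- int n..int n}. fourier_coeff u k * fourier_mode k x) \<longlonglongrightarrow> S"
    unfolding has_sum_def by (rule filterlim_compose[OF _ filterlim_symmetric_intervals])
  moreover have "(\<lambda>n. \<Sum>k\<in>{- int n..int n}. fourier_coeff u k * fourier_mode k x) \<longlonglongrightarrow> of_real (u x)"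
    using fourier_partial_sums_at_0[OF Cinf_circle_shift[OF u, of x]]
    by (simp add: fourier_coeff_shift[OF u])
  ultimately have "S = of_real (u x)" by (rule LIMSEQ_unique)
  then show ?thesis using S by simp
qed

theorem Lambda_series:
  assumes u: "u \<in> Cinf_circle"
  shows "((\<lambda>k. of_real (Lambda_symbol a k) * fourier_coeff u k * fourier_mode k x)
           has_sum of_real (Lambda_mu a u x)) UNIV"
proof (cases "a = 0")
  case True
  then show ?thesis using Fourier_inversion[OF u] by (simp add: Lambda_mu_def)
next
  case False
  define t where "t = (\<lambda>k. of_real (Lambda_symbol a k) * fourier_coeff u k * fourier_mode k x)"
  define S where "S = infsum t UNIV"
  have t: "t summable_on UNIV" unfolding t_def by (rule Lambda_series_summable[OF u])
  then have S: "(t has_sum S) UNIV" unfolding S_def by (rule has_sum_infsum)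
  \<comment> \<open>Conjugation replaces \<open>k\<close> by \<open>- k\<close>, so the sum is real
    and taking \<open>Re\<close> in the definition of the operator loses nothing.\<close>
  have "cnj S = (\<Sum>\<^sub>\<infinity>k. t (- k))"
    unfolding S_def infsum_cnj[symmetric]
    by (intro infsum_cong) (simp add: t_def fourier_coeff_minus)
  also have "\<dots> = S"
    unfolding S_def by (rule infsum_reindex_bij_witness[of _ uminus uminus]) auto
  finally have real: "of_real (Re S) = S"
    by (simp add: complex_eq_iff)
  have "infsum t (insert 0 (UNIV - {0})) = t 0 + infsum t (UNIV - {0})"
    by (rule infsum_insert) (use t summable_on_subset_banach in auto)
  moreover have "insert 0 (UNIV - {0}) = (UNIV :: int set)" by auto
  ultimately have "S = fourier_coeff u 0 + infsum t (UNIV - {0})"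
    by (simp add: S_def t_def)
  moreover have "infsum t (UNIV - {0}) =
      (\<Sum>\<^sub>\<infinity>k\<in>UNIV - {0}. of_real (\<bar>of_int k\<bar> powr a) * fourier_coeff u k * cis (2 * pi * of_int k * x))"
    by (intro infsum_cong) (simp add: t_def Lambda_symbol_def fourier_mode_def)
  ultimately have "Re S = Lambda_mu a u x"
    using False by (simp add: Lambda_mu_def fractional_laplacian_def fourier_coeff_0[OF u])
  then show ?thesis using S real by (simp add: t_def)
qed

text \<open>Both functions are sums of the same series. Naming a smooth candidate \<open>v\<close>
  allows \<open>Lambda_mu a w\<close> to be computed from coefficients alone.\<close>

lemma Lambda_eqI:
  assumes w: "w \<in> Cinf_circle" and v: "v \<in> Cinf_circle"
    and eq: "\<And>k. fourier_coeff v k = of_real (Lambda_symbol a k) * fourier_coeff w k"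
  shows "Lambda_mu a w = v"
proof
  fix x
  have "complex_of_real (Lambda_mu a w x) = of_real (v x)"
    using Lambda_series[OF w, of a x] Fourier_inversion[OF v, of x] 
    unfolding eq by (rule has_sum_unique)
  then show "Lambda_mu a w x = v x" by simp
qed

text \<open>The series of \<open>Lambda_mu a u\<close> converges uniformly by the Weierstrass test,
  so it may be integrated termwise against a mode. By orthogonality every finite partial sum
  containing \<open>k\<close> already has the final coefficient.\<close>

lemma fourier_coeff_Lambda:
  assumes u: "u \<in> Cinf_circle"
  shows "fourier_coeff (Lambda_mu a u) k = of_real (Lambda_symbol a k) * fourier_coeff u k"
proof -
  define c where "c = (\<lambda>j. of_real (Lambda_symbol a j) * fourier_coeff u j)"
  have "uniform_limit {0..1} (\<lambda>F x. \<Sum>j\<in>F. c j * fourier_mode j x * fourier_mode (- k) x)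
      (\<lambda>x. of_real (Lambda_mu a u x) * fourier_mode (- k) x) (finite_subsets_at_top UNIV)"
  proof (rule Weierstrass_m_test_general')
    show "norm (c j * fourier_mode j x * fourier_mode (- k) x) \<le> Lambda_symbol a j * norm (fourier_coeff u j)"
      for j x by (simp add: c_def norm_mult less_imp_le[OF Lambda_symbol_pos])
    show "((\<lambda>j. c j * fourier_mode j x * fourier_mode (- k) x)
        has_sum of_real (Lambda_mu a u x) * fourier_mode (- k) x) UNIV" for x
      unfolding c_def by (intro has_sum_cmult_left Lambda_series u)
  qed (rule Lambda_symbol_summable[OF u])
  then obtain I J where
    I: "\<And>F. ((\<lambda>x. \<Sum>j\<in>F. c j * fourier_mode j x * fourier_mode (- k) x) has_integral I F) {0..1}"
    and J: "((\<lambda>x. of_real (Lambda_mu a u x) * fourier_mode (- k) x) has_integral J) {0..1}"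
    and lim: "(I \<longlongrightarrow> J) (finite_subsets_at_top UNIV)"
    by (rule uniform_limit_integral) (auto intro!: continuous_intros)
  have "I F = c k" if "finite F" "k \<in> F" for F
    using complex_coeff_sum_modes[OF that(1), of c k] integral_unique[OF I[of F]] that
    by (simp add: complex_coeff_def sum_distrib_right)
  then have "\<forall>\<^sub>F F in finite_subsets_at_top UNIV. I F = c k"
    unfolding eventually_finite_subsets_at_top by (intro exI[of _ "{k}"]) auto
  then have "(I \<longlongrightarrow> c k) (finite_subsets_at_top UNIV)" by (rule tendsto_eventually)
  then have "J = c k" using lim tendsto_unique finite_subsets_at_top_neq_bot by blast
  then show ?thesis using J by (simp add: c_def fourier_coeff_alt integral_unique)
qed

text \<open>Order 0 of \<open>Lambda_eqI\<close>, where the symbol is 1 and the operator is the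
  identity.\<close>

lemma Cinf_circle_eqI:
  assumes "u \<in> Cinf_circle" "v \<in> Cinf_circle" "\<And>k. fourier_coeff u k = fourier_coeff v k"
  shows "u = v"
  using Lambda_eqI[of u v 0] assms by (simp add: Lambda_mu_def)

text \<open>The symbol has no zeros. Injectivity makes \<open>op_inverse (Lambda_mu a)\<close> a
  left inverse, which is how the Euler equation is evaluated.\<close>

lemma inj_on_Lambda: "inj_on (Lambda_mu a) Cinf_circle"
proof (rule inj_onI)
  fix u v assume uv: "u \<in> Cinf_circle" "v \<in> Cinf_circle" and eq: "Lambda_mu a u = Lambda_mu a v"
  have "complex_of_real (Lambda_symbol a k) * fourier_coeff u k = of_real (Lambda_symbol a k) * fourier_coeff v k" for k
    using fourier_coeff_Lambda[OF uv(1), of a k] fourier_coeff_Lambda[OF uv(2), of a k] eq by simp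
  then show "u = v" by (intro Cinf_circle_eqI uv) simp
qed

section \<open>Trigonometric modes\<close>

definition cos_mode :: "int \<Rightarrow> real \<Rightarrow> real" where
  "cos_mode k x = cos (2 * pi * of_int k * x)"

definition sin_mode :: "int \<Rightarrow> real \<Rightarrow> real" where
  "sin_mode k x = sin (2 * pi * of_int k * x)"

lemma cos_mode_0: "cos_mode 0 = (\<lambda>x. 1)"
  by (simp add: cos_mode_def fun_eq_iff)

lemma sin_mode_0: "sin_mode 0 = (\<lambda>x. 0)"
  by (simp add: sin_mode_def fun_eq_iff)

lemma cos_mode_minus: "cos_mode (- k) = cos_mode k"
  by (simp add: cos_mode_def fun_eq_iff)

lemma sin_mode_minus: "sin_mode (- k) = (\<lambda>x. (- 1) * sin_mode k x)"
  by (simp add: sin_mode_def fun_eq_iff)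

lemma sin_mode_double: "sin_mode (2 * k) x = 2 * (sin_mode k x * cos_mode k x)"
  using sin_double[of "2 * pi * of_int k * x"]
  by (simp add: sin_mode_def cos_mode_def mult.assoc mult.left_commute)

lemma cos_mode_double: "cos_mode (2 * k) x = cos_mode k x * cos_mode k x - sin_mode k x * sin_mode k x"
  using cos_double[of "2 * pi * of_int k * x"]
  by (simp add: sin_mode_def cos_mode_def mult.assoc mult.left_commute power2_eq_square)

lemma has_derivative_cos_mode:
  "(cos_mode k has_field_derivative - (2 * pi * of_int k) * sin_mode k x) (at x)"
  unfolding cos_mode_def sin_mode_def by (auto intro!: derivative_eq_intros)

lemma has_derivative_sin_mode:
  "(sin_mode k has_field_derivative (2 * pi * of_int k) * cos_mode k x) (at x)"
  unfolding cos_mode_def sin_mode_def by (auto intro!: derivative_eq_intros)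

lemma deriv_cos_mode: "deriv (cos_mode k) = (\<lambda>x. - (2 * pi * of_int k) * sin_mode k x)"
  by (intro ext DERIV_imp_deriv has_derivative_cos_mode)

lemma deriv_sin_mode: "deriv (sin_mode k) = (\<lambda>x. (2 * pi * of_int k) * cos_mode k x)"
  by (intro ext DERIV_imp_deriv has_derivative_sin_mode)

text \<open>The family with arbitrary \<open>p\<close> and \<open>q\<close> is closed under
  \<open>deriv\<close>, so all iterated derivatives stay in it.\<close>

lemma Cinf_circle_trig: "(\<lambda>x. p * cos_mode k x + q * sin_mode k x) \<in> Cinf_circle"
proof -
  have d: "((\<lambda>x. p * cos_mode k x + q * sin_mode k x) has_field_derivative
      (q * (2 * pi * of_int k)) * cos_mode k x + (- p * (2 * pi * of_int k)) * sin_mode k x) (at x)" for p q x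
    by (auto intro!: derivative_eq_intros has_derivative_cos_mode has_derivative_sin_mode)
  have "\<exists>p' q'. (deriv ^^ n) (\<lambda>x. p * cos_mode k x + q * sin_mode k x) =
      (\<lambda>x. p' * cos_mode k x + q' * sin_mode k x)" for n
  proof (induction n)
    case (Suc n)
    then obtain p' q' where "(deriv ^^ n) (\<lambda>x. p * cos_mode k x + q * sin_mode k x) =
      (\<lambda>x. p' * cos_mode k x + q' * sin_mode k x)" by blast
    then have "(deriv ^^ Suc n) (\<lambda>x. p * cos_mode k x + q * sin_mode k x) =
      (\<lambda>x. (q' * (2 * pi * of_int k)) * cos_mode k x + (- p' * (2 * pi * of_int k)) * sin_mode k x)"
      by (simp only: funpow.simps comp_apply) (intro ext DERIV_imp_deriv d)
    then show ?case by blast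
  qed auto
  then have "(deriv ^^ n) (\<lambda>x. p * cos_mode k x + q * sin_mode k x) field_differentiable (at x)" for n x
    using d field_differentiable_def by metis
  moreover have "cos_mode k (x + 1) = cos_mode k x" "sin_mode k (x + 1) = sin_mode k x" for x
    using fourier_mode_add[of k x 1] by (simp_all add: fourier_mode_def complex_eq_iff cos_mode_def sin_mode_def)
  ultimately show ?thesis by (simp add: Cinf_circle_def)
qed

lemma Cinf_circle_cos_mode: "cos_mode k \<in> Cinf_circle"
  using Cinf_circle_trig[of 1 k 0] by simp

lemma Cinf_circle_sin_mode: "sin_mode k \<in> Cinf_circle"
  using Cinf_circle_trig[of 0 k 1] by simp

lemmas Cinf_circle_intros =
  Cinf_circle_add Cinf_circle_mult Cinf_circle_cmult Cinf_circle_deriv Cinf_circle_const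
  Cinf_circle_cos_mode Cinf_circle_sin_mode

lemma fourier_mode_eq_trig: "fourier_mode k x = of_real (cos_mode k x) + \<i> * of_real (sin_mode k x)"
  by (simp add: fourier_mode_def cos_mode_def sin_mode_def complex_eq_iff)

lemma fourier_coeff_mult_cos_mode:
  assumes u: "u \<in> Cinf_circle"
  shows "fourier_coeff (\<lambda>x. u x * cos_mode k x) j = (fourier_coeff u (j - k) + fourier_coeff u (j + k)) / 2"
proof -
  have "of_real (cos_mode k x) * fourier_mode (- j) x =
      (fourier_mode (- (j - k)) x + fourier_mode (- (j + k)) x) / 2" for x
  proof -
    have "of_real (cos_mode k x) = (fourier_mode k x + fourier_mode (- k) x) / 2"
      by (simp add: fourier_mode_eq_trig cos_mode_minus sin_mode_minus)
    then show ?thesis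
      by (simp only: times_divide_eq_left distrib_right fourier_mode_mult) (simp add: algebra_simps)
  qed
  then have eq: "of_real (u x * cos_mode k x) * fourier_mode (- j) x =
      (of_real (u x) * fourier_mode (- (j - k)) x + of_real (u x) * fourier_mode (- (j + k)) x) / 2" for x
    by (simp add: mult.assoc distrib_left)
  have "fourier_coeff (\<lambda>x. u x * cos_mode k x) j = integral {0..1} (\<lambda>x.
      (of_real (u x) * fourier_mode (- (j - k)) x + of_real (u x) * fourier_mode (- (j + k)) x) / 2)"
    unfolding fourier_coeff_alt by (simp only: eq)
  also have "\<dots> = (fourier_coeff u (j - k) + fourier_coeff u (j + k)) / 2"
    unfolding fourier_coeff_alt integral_divide
    by (subst integral_add) (intro fourier_coeff_integrable u refl)+
  finally show ?thesis .
qed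

lemma fourier_coeff_mult_sin_mode:
  assumes u: "u \<in> Cinf_circle"
  shows "fourier_coeff (\<lambda>x. u x * sin_mode k x) j =
    (fourier_coeff u (j - k) - fourier_coeff u (j + k)) / (2 * \<i>)"
proof -
  have "of_real (sin_mode k x) * fourier_mode (- j) x =
      (fourier_mode (- (j - k)) x - fourier_mode (- (j + k)) x) / (2 * \<i>)" for x
  proof -
    have "of_real (sin_mode k x) = (fourier_mode k x - fourier_mode (- k) x) / (2 * \<i>)"
      by (simp add: fourier_mode_eq_trig cos_mode_minus sin_mode_minus)
    then show ?thesis
      by (simp only: times_divide_eq_left left_diff_distrib fourier_mode_mult) (simp add: algebra_simps)
  qed
  then have eq: "of_real (u x * sin_mode k x) * fourier_mode (- j) x =
      (of_real (u x) * fourier_mode (- (j - k)) x - of_real (u x) * fourier_mode (- (j + k)) x) / (2 * \<i>)" for x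
    by (simp add: mult.assoc right_diff_distrib)
  have "fourier_coeff (\<lambda>x. u x * sin_mode k x) j = integral {0..1} (\<lambda>x.
      (of_real (u x) * fourier_mode (- (j - k)) x - of_real (u x) * fourier_mode (- (j + k)) x) / (2 * \<i>))"
    unfolding fourier_coeff_alt by (simp only: eq)
  also have "\<dots> = (fourier_coeff u (j - k) - fourier_coeff u (j + k)) / (2 * \<i>)"
    unfolding fourier_coeff_alt integral_divide
    by (subst integral_diff) (intro fourier_coeff_integrable u refl)+
  finally show ?thesis .
qed

lemma fourier_coeff_const: "fourier_coeff (\<lambda>x. c) j = of_real c * of_bool (j = 0)"
  using complex_coeff_one[of "of_real c" j] by (simp add: fourier_coeff_eq_complex)

lemma fourier_coeff_cos_mode:
  "fourier_coeff (cos_mode k) j = (of_bool (j = k) + of_bool (j = - k)) / 2"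
  using fourier_coeff_mult_cos_mode[OF Cinf_circle_const[of 1], of k j]
  by (simp add: fourier_coeff_const eq_neg_iff_add_eq_0)

lemma fourier_coeff_sin_mode:
  "fourier_coeff (sin_mode k) j = (of_bool (j = k) - of_bool (j = - k)) / (2 * \<i>)"
  using fourier_coeff_mult_sin_mode[OF Cinf_circle_const[of 1], of k j]
  by (simp add: fourier_coeff_const eq_neg_iff_add_eq_0)

text \<open>Expresses coefficients by inner products with real modes, to which the symmetry of the
  inertia operator applies.\<close>

lemma fourier_coeff_eq_L2_inner:
  assumes u: "u \<in> Cinf_circle"
  shows "fourier_coeff u k = Complex (L2_inner u (cos_mode k)) (- L2_inner u (sin_mode k))"
proof -
  have "(\<lambda>x. u x * cos_mode k x) integrable_on {0..1}" "(\<lambda>x. u x * sin_mode k x) integrable_on {0..1}"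
    by (intro integrable_continuous_real Cinf_circle_continuous Cinf_circle_intros u)+
  then have "((\<lambda>x. complex_of_real (u x * cos_mode k x) - \<i> * of_real (u x * sin_mode k x)) has_integral
      of_real (L2_inner u (cos_mode k)) - \<i> * of_real (L2_inner u (sin_mode k))) {0..1}"
    unfolding L2_inner_def
    by (intro has_integral_diff has_integral_mult_right has_integral_of_real integrable_integral)
  moreover have "complex_of_real (u x * cos_mode k x) - \<i> * of_real (u x * sin_mode k x) =
      of_real (u x) * fourier_mode (- k) x" for x
    by (simp add: fourier_mode_eq_trig cos_mode_minus sin_mode_minus algebra_simps)
  ultimately have "((\<lambda>x. of_real (u x) * fourier_mode (- k) x) has_integral
      of_real (L2_inner u (cos_mode k)) - \<i> * of_real (L2_inner u (sin_mode k))) {0..1}"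
    by (simp only:)
  from integral_unique[OF this] show ?thesis
    by (simp add: fourier_coeff_alt complex_eq_iff)
qed

lemma Lambda_cos_mode: "Lambda_mu a (\<lambda>x. c * cos_mode k x) = (\<lambda>x. c * Lambda_symbol a k * cos_mode k x)"
  by (intro Lambda_eqI Cinf_circle_intros)
     (auto simp: fourier_coeff_cmult fourier_coeff_cos_mode)

lemma Lambda_sin_mode: "Lambda_mu a (\<lambda>x. c * sin_mode k x) = (\<lambda>x. c * Lambda_symbol a k * sin_mode k x)"
  by (intro Lambda_eqI Cinf_circle_intros)
     (auto simp: fourier_coeff_cmult fourier_coeff_sin_mode)

text \<open>With smooth images, the sum on the right is a smooth candidate and comparison of
  coefficients suffices.\<close>

lemma Lambda_add:
  assumes "u \<in> Cinf_circle" "v \<in> Cinf_circle" "Lambda_mu a u \<in> Cinf_circle" "Lambda_mu a v \<in> Cinf_circle"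
  shows "Lambda_mu a (\<lambda>x. u x + v x) = (\<lambda>x. Lambda_mu a u x + Lambda_mu a v x)"
  using assms
  by (intro Lambda_eqI Cinf_circle_add) (simp_all add: fourier_coeff_add fourier_coeff_Lambda distrib_left)

lemma deriv_add_Cinf:
  assumes "u \<in> Cinf_circle" "v \<in> Cinf_circle"
  shows "deriv (\<lambda>x. u x + v x) = (\<lambda>x. deriv u x + deriv v x)"
  by (intro ext DERIV_imp_deriv DERIV_add Cinf_circle_has_derivative assms)

lemma deriv_cmult_Cinf:
  assumes "u \<in> Cinf_circle"
  shows "deriv (\<lambda>x. c * u x) = (\<lambda>x. c * deriv u x)"
  by (intro ext DERIV_imp_deriv DERIV_cmult Cinf_circle_has_derivative assms)

section \<open>The Euler equation in Fourier modes\<close>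

locale euler_inertia =
  fixes a b :: real and A :: "(real \<Rightarrow> real) \<Rightarrow> real \<Rightarrow> real"
  assumes regular: "A \<in> regular_inertia_operators"
    and euler: "is_euler_equation a b A"
begin

section \<open>The Euler equation with explicit preimages\<close>

lemma A_closed: "u \<in> Cinf_circle \<Longrightarrow> A u \<in> Cinf_circle"
  using regular by (auto simp: regular_inertia_operators_def bij_betw_def)

lemma A_add: "u \<in> Cinf_circle \<Longrightarrow> v \<in> Cinf_circle \<Longrightarrow> A (\<lambda>x. u x + v x) = (\<lambda>x. A u x + A v x)"
  using regular by (auto simp: regular_inertia_operators_def)

lemma A_cmult: "u \<in> Cinf_circle \<Longrightarrow> A (\<lambda>x. c * u x) = (\<lambda>x. c * A u x)"
  using regular by (auto simp: regular_inertia_operators_def)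

lemma A_symmetric: "u \<in> Cinf_circle \<Longrightarrow> v \<in> Cinf_circle \<Longrightarrow> L2_inner (A u) v = L2_inner u (A v)"
  using regular by (auto simp: regular_inertia_operators_def)

lemma A_bij: "bij_betw A Cinf_circle Cinf_circle"
  using regular by (simp add: regular_inertia_operators_def)

text \<open>If the right-hand side of the family is \<open>Lambda_mu a w\<close> for a known smooth
  \<open>w\<close>, its preimage is \<open>w\<close> by injectivity. Applying \<open>A\<close> to
  the Euler equation then removes both inverses.\<close>

lemma euler_diag:
  assumes u: "u \<in> Cinf_circle" and w: "w \<in> Cinf_circle"
    and L: "Lambda_mu a w = (\<lambda>y. b * Lambda_mu a u y * deriv u y + u y * deriv (Lambda_mu a u) y)"
  shows "A w = (\<lambda>y. 2 * A u y * deriv u y + u y * deriv (A u) y)"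
proof -
  let ?r = "\<lambda>y. 2 * A u y * deriv u y + u y * deriv (A u) y"
  have "op_inverse A ?r = op_inverse (Lambda_mu a) (Lambda_mu a w)"
    using euler u unfolding is_euler_equation_iff[OF regular] L by blast
  also have "\<dots> = w" by (rule inv_into_f_f[OF inj_on_Lambda w])
  finally have "op_inverse A ?r = w" .
  moreover have "A (op_inverse A ?r) = ?r"
    by (rule bij_betw_inv_into_right[OF A_bij euler_rhs_in_Cinf[OF regular u]])
  ultimately show ?thesis by simp
qed

text \<open>For an eigenfunction, the two terms of the family are both multiples of
  \<open>u y * deriv u y\<close>.\<close>

lemma euler_eigen:
  assumes u: "u \<in> Cinf_circle" and w: "w \<in> Cinf_circle"
    and Lu: "Lambda_mu a u = (\<lambda>y. l * u y)"
    and Lw: "Lambda_mu a w = (\<lambda>y. (b + 1) * l * (u y * deriv u y))"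
  shows "A w = (\<lambda>y. 2 * A u y * deriv u y + u y * deriv (A u) y)"
  by (rule euler_diag[OF u w]) (simp add: Lw Lu deriv_cmult_Cinf[OF u] algebra_simps)

text \<open>The identity at \<open>u + v\<close> minus those at \<open>u\<close> and at
  \<open>v\<close>. The functions \<open>wu\<close>, \<open>wv\<close> and \<open>w\<close> are the
  preimages of the two pure parts and of the mixed part.\<close>

lemma euler_polarised:
  assumes u: "u \<in> Cinf_circle" and v: "v \<in> Cinf_circle"
    and wu: "wu \<in> Cinf_circle" and wv: "wv \<in> Cinf_circle" and w: "w \<in> Cinf_circle"
    and Lu: "Lambda_mu a u = (\<lambda>y. l * u y)" and Lv: "Lambda_mu a v = (\<lambda>y. m * v y)"
    and Lwu: "Lambda_mu a wu = (\<lambda>y. (b + 1) * l * (u y * deriv u y))"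
    and Lwv: "Lambda_mu a wv = (\<lambda>y. (b + 1) * m * (v y * deriv v y))"
    and Lw: "Lambda_mu a w = (\<lambda>y. (b * l + m) * (u y * deriv v y) + (b * m + l) * (v y * deriv u y))"
  shows "A w = (\<lambda>y. 2 * A u y * deriv v y + 2 * A v y * deriv u y + u y * deriv (A v) y + v y * deriv (A u) y)"
proof -
  note C = Cinf_circle_intros u v wu wv w
  let ?s = "\<lambda>x. u x + v x" and ?ws = "\<lambda>x. wu x + wv x + w x"
  have Ls: "Lambda_mu a ?s = (\<lambda>y. l * u y + m * v y)"
    by (subst Lambda_add) (simp_all add: Lu Lv C)
  have Lws1: "Lambda_mu a (\<lambda>x. wu x + wv x) = (\<lambda>y. Lambda_mu a wu y + Lambda_mu a wv y)"
    by (rule Lambda_add) (simp_all only: Lwu Lwv, (intro C)+)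
  have "Lambda_mu a ?ws = (\<lambda>y. Lambda_mu a (\<lambda>x. wu x + wv x) y + Lambda_mu a w y)"
    by (rule Lambda_add) (simp_all only: Lws1 Lwu Lwv Lw, (intro C)+)
  then have Lws: "Lambda_mu a ?ws = (\<lambda>y. Lambda_mu a wu y + Lambda_mu a wv y + Lambda_mu a w y)"
    by (simp only: Lws1)
  have "deriv (\<lambda>y. l * u y + m * v y) = (\<lambda>y. l * deriv u y + m * deriv v y)"
    by (simp add: deriv_add_Cinf deriv_cmult_Cinf C)
  note deriv_s = this
  have "A ?ws = (\<lambda>y. 2 * A ?s y * deriv ?s y + ?s y * deriv (A ?s) y)"
    by (intro euler_diag C)
       (simp only: Lws Ls Lwu Lwv Lw deriv_s deriv_add_Cinf[OF u v], simp add: algebra_simps)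
  also have "\<dots> = (\<lambda>y. 2 * (A u y + A v y) * (deriv u y + deriv v y) + (u y + v y) * (deriv (A u) y + deriv (A v) y))"
    by (simp add: A_add[OF u v] deriv_add_Cinf u v A_closed)
  finally have "A wu x + A wv x + A w x = 2 * (A u x + A v x) * (deriv u x + deriv v x)
      + (u x + v x) * (deriv (A u) x + deriv (A v) x)" for x
    by (simp add: A_add C fun_eq_iff)
  then show ?thesis
    unfolding euler_eigen[OF u wu Lu Lwu] euler_eigen[OF v wv Lv Lwv]
    by (simp add: fun_eq_iff algebra_simps)
qed

lemma Lambda_cos: "Lambda_mu a (cos_mode k) = (\<lambda>x. Lambda_symbol a k * cos_mode k x)"
  using Lambda_cos_mode[of a 1 k] by simp

lemma Lambda_sin: "Lambda_mu a (sin_mode k) = (\<lambda>x. Lambda_symbol a k * sin_mode k x)"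
  using Lambda_sin_mode[of a 1 k] by simp

text \<open>The product \<open>1 * 1\<close> matches the eigenfunction pattern
  \<open>l * u y\<close> of the previous lemmas.\<close>

lemma Lambda_one: "Lambda_mu a (\<lambda>x. 1) = (\<lambda>x. 1 * 1)"
  using Lambda_cos[of 0] by (simp add: cos_mode_0)

lemma Lambda_zero: "Lambda_mu a (\<lambda>x. 0) = (\<lambda>x. 0)"
  using Lambda_cos_mode[of a 0 0] by simp

lemma A_zero: "A (\<lambda>x. 0) = (\<lambda>x. 0)"
  using A_cmult[OF Cinf_circle_const[of 0], of 0] by simp

text \<open>At \<open>u = 1\<close> the preimage is 0 and the equation reduces to
  \<open>deriv (A 1) = 0\<close>; injectivity of \<open>A\<close> excludes
  \<open>c = 0\<close>.\<close>

lemma A_one: obtains c where "c \<noteq> 0" "A (\<lambda>x. 1) = (\<lambda>x. c)"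
proof -
  have "A (\<lambda>x. 0) = (\<lambda>y. 2 * A (\<lambda>x. 1) y * deriv (\<lambda>x. 1) y + 1 * deriv (A (\<lambda>x. 1)) y)"
    by (rule euler_eigen[OF Cinf_circle_const Cinf_circle_const Lambda_one]) (simp add: Lambda_zero)
  then have "deriv (A (\<lambda>x. 1)) y = 0" for y by (simp add: A_zero fun_eq_iff)
  then have "(A (\<lambda>x. 1) has_field_derivative 0) (at y)" for y
    using Cinf_circle_has_derivative[OF A_closed[OF Cinf_circle_const], of 1 y UNIV] by simp
  then obtain c where c: "A (\<lambda>x. 1) y = c" for y
    using DERIV_const_ratio_const DERIV_isconst_all by metis
  moreover have "c \<noteq> 0"
  proof
    assume "c = 0"
    then have "A (\<lambda>x. 1) = A (\<lambda>x. 0)" using c by (simp add: A_zero fun_eq_iff)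
    then have "(\<lambda>x. 1) = (\<lambda>x::real. 0::real)"
      using A_bij Cinf_circle_const by (metis bij_betw_imp_inj_on inj_onD)
    then show False by (metis zero_neq_one)
  qed
  ultimately show ?thesis using that[of c] by (simp add: fun_eq_iff)
qed

text \<open>Provides the preimages \<open>wu\<close> and \<open>wv\<close> for trigonometric modes:
  a mode times its derivative is a multiple of \<open>sin_mode (2 * k)\<close>.\<close>

lemma Lambda_sin_double:
  "Lambda_mu a (\<lambda>x. (- (b + 1) * pi * of_int k * (Lambda_symbol a k / Lambda_symbol a (2 * k))) * sin_mode (2 * k) x) =
    (\<lambda>y. (b + 1) * Lambda_symbol a k * (cos_mode k y * deriv (cos_mode k) y))"
  "Lambda_mu a (\<lambda>x. ((b + 1) * pi * of_int k * (Lambda_symbol a k / Lambda_symbol a (2 * k))) * sin_mode (2 * k) x) =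
    (\<lambda>y. (b + 1) * Lambda_symbol a k * (sin_mode k y * deriv (sin_mode k) y))"
  unfolding Lambda_sin_mode unfolding deriv_cos_mode deriv_sin_mode sin_mode_double
  by (intro ext; simp add: field_simps)+

lemma euler_with_one:
  assumes c: "A (\<lambda>x. 1) = (\<lambda>x. c)"
    and v: "v \<in> Cinf_circle" and wv: "wv \<in> Cinf_circle" and w: "w \<in> Cinf_circle"
    and Lv: "Lambda_mu a v = (\<lambda>y. m * v y)"
    and Lwv: "Lambda_mu a wv = (\<lambda>y. (b + 1) * m * (v y * deriv v y))"
    and Lw: "Lambda_mu a w = (\<lambda>y. (b + m) * deriv v y)"
  shows "A w = (\<lambda>y. 2 * c * deriv v y + deriv (A v) y)"
  using euler_polarised[OF Cinf_circle_const v Cinf_circle_const wv w Lambda_one Lv _ Lwv, of 0]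
  by (simp add: Lambda_zero Lw c)

section \<open>The matrix of \<open>A\<close> in Fourier modes and the value of
  \<open>b\<close>\<close>

text \<open>The coefficient at \<open>j\<close> of the complex-linear extension of \<open>A\<close>
  applied to \<open>fourier_mode k\<close>, written with real and imaginary parts since
  \<open>A\<close> acts on real functions.\<close>

definition mode_matrix :: "int \<Rightarrow> int \<Rightarrow> complex" where
  "mode_matrix j k = fourier_coeff (A (cos_mode k)) j + \<i> * fourier_coeff (A (sin_mode k)) j"

text \<open>The coefficient at \<open>j\<close> of the equation polarised at the constant 1 and
  \<open>fourier_mode k\<close>, divided by \<open>2 * pi * \<i>\<close>; the cosine and sine
  equations are its two parts.\<close>

lemma mode_matrix_eq:
  assumes c: "A (\<lambda>x. 1) = (\<lambda>x. c)"
  shows "(of_int k * (1 + of_real (b / Lambda_symbol a k)) - of_int j) * mode_matrix j k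
    = 2 * of_real c * of_int k * of_bool (j = k)"
proof -
  define l where "l = Lambda_symbol a k"
  have l: "l \<noteq> 0" "Lambda_symbol a k = l" by (simp_all add: l_def)
  \<comment> \<open>Chosen so that \<open>\<i> * p * fourier_mode k\<close> is the preimage of
    \<open>b + Lambda_symbol a k\<close> times the derivative of the mode.\<close>
  define p where "p = 2 * pi * of_int k * (1 + b / l)"
  let ?C = "fourier_coeff (A (cos_mode k)) j" and ?S = "fourier_coeff (A (sin_mode k)) j"
  note C = Cinf_circle_intros A_closed
  have L: "Lambda_mu a (\<lambda>x. - p * sin_mode k x) = (\<lambda>y. (b + Lambda_symbol a k) * deriv (cos_mode k) y)"
    "Lambda_mu a (\<lambda>x. p * cos_mode k x) = (\<lambda>y. (b + Lambda_symbol a k) * deriv (sin_mode k) y)"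
    unfolding Lambda_sin_mode Lambda_cos_mode deriv_cos_mode deriv_sin_mode
    unfolding l(2) p_def by (intro ext; use l(1) in \<open>simp add: field_simps\<close>)+
  have "A (\<lambda>x. - p * sin_mode k x) = (\<lambda>y. 2 * c * deriv (cos_mode k) y + deriv (A (cos_mode k)) y)"
    by (rule euler_with_one[OF c _ _ _ Lambda_cos Lambda_sin_double(1) L(1)]) (intro C)+
  from arg_cong[OF this, of "\<lambda>f. fourier_coeff f j"]
  have 1: "- of_real p * ?S = 2 * c * (- (2 * pi * of_int k) * fourier_coeff (sin_mode k) j)
      + 2 * pi * \<i> * of_int j * ?C"
    by (simp only: A_cmult deriv_cos_mode C fourier_coeff_add fourier_coeff_cmult fourier_coeff_deriv) simp
  have "A (\<lambda>x. p * cos_mode k x) = (\<lambda>y. 2 * c * deriv (sin_mode k) y + deriv (A (sin_mode k)) y)"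
    by (rule euler_with_one[OF c _ _ _ Lambda_sin Lambda_sin_double(2) L(2)]) (intro C)+
  from arg_cong[OF this, of "\<lambda>f. fourier_coeff f j"]
  have 2: "of_real p * ?C = 2 * c * (2 * pi * of_int k * fourier_coeff (cos_mode k) j)
      + 2 * pi * \<i> * of_int j * ?S"
    by (simp add: A_cmult deriv_sin_mode C fourier_coeff_add fourier_coeff_cmult fourier_coeff_deriv)
  have "\<i> * of_real p * mode_matrix j k = - of_real p * ?S + \<i> * (of_real p * ?C)"
    by (simp add: mode_matrix_def algebra_simps)
  also have "\<dots> = 2 * pi * \<i> * (2 * c * of_int k * (fourier_coeff (cos_mode k) j + \<i> * fourier_coeff (sin_mode k) j)
      + of_int j * mode_matrix j k)"
    unfolding 1 2 mode_matrix_def by (simp add: algebra_simps)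
  also have "fourier_coeff (cos_mode k) j + \<i> * fourier_coeff (sin_mode k) j = of_bool (j = k)"
    by (simp add: fourier_coeff_cos_mode fourier_coeff_sin_mode)
  finally have "2 * pi * \<i> * (of_int k * (1 + of_real (b / l)) * mode_matrix j k) =
      2 * pi * \<i> * (2 * c * of_int k * of_bool (j = k) + of_int j * mode_matrix j k)"
    by (simp add: p_def mult_ac)
  then have "of_int k * (1 + of_real (b / l)) * mode_matrix j k =
      2 * c * of_int k * of_bool (j = k) + of_int j * mode_matrix j k"
    by simp
  then show ?thesis by (simp add: l_def left_diff_distrib)
qed

text \<open>For \<open>b = 0\<close> the left side of \<open>mode_matrix_eq\<close> vanishes on the
  diagonal, while the right side at \<open>j = k = 1\<close> is \<open>2 * c\<close>.\<close>

lemma b_neq_0: "b \<noteq> 0"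
proof
  assume b: "b = 0"
  obtain c where c: "c \<noteq> 0" "A (\<lambda>x. 1) = (\<lambda>x. c)" by (rule A_one)
  from mode_matrix_eq[OF c(2), of 1 1] show False using b c(1) by simp
qed

lemma mode_matrix_diag:
  assumes c: "A (\<lambda>x. 1) = (\<lambda>x. c)" and k: "k \<noteq> 0"
  shows "mode_matrix k k = of_real (2 * c * Lambda_symbol a k / b)"
proof -
  have "of_int k * (of_real (b / Lambda_symbol a k) * mode_matrix k k) = of_int k * (2 * of_real c)"
    using mode_matrix_eq[OF c, of k k] by (simp add: algebra_simps)
  then have "of_real (b / Lambda_symbol a k) * mode_matrix k k = 2 * of_real c"
    using k by (metis mult_left_cancel of_int_eq_0_iff)
  then show ?thesis using b_neq_0 by (simp add: field_simps)
qed

text \<open>The coefficient at \<open>2\<close> of the complexified equation for \<open>u = v = fourier_mode 1\<close>.\<close>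

lemma mode_matrix_quadratic:
  "3 * mode_matrix 1 1 = of_real ((b + 1) / Lambda_symbol a 2) * mode_matrix 2 2"
proof -
  \<comment> \<open>Makes \<open>2 * \<i> * q * fourier_mode 2\<close> the preimage of
    \<open>b + 1\<close> times the product of \<open>fourier_mode 1\<close> and its
    derivative.\<close>
  define q where "q = (b + 1) * pi / Lambda_symbol a 2"
  define f where "f = A (cos_mode 1)"
  define g where "g = A (sin_mode 1)"
  define F where "F = fourier_coeff f"
  define G where "G = fourier_coeff g"
  note C = Cinf_circle_intros A_closed
  have f: "f \<in> Cinf_circle" and g: "g \<in> Cinf_circle" unfolding f_def g_def by (intro C)+
  have L: "Lambda_mu a (\<lambda>x. - q * sin_mode 2 x) = (\<lambda>y. (b + 1) * Lambda_symbol a 1 * (cos_mode 1 y * deriv (cos_mode 1) y))"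
     "Lambda_mu a (\<lambda>x. q * sin_mode 2 x) = (\<lambda>y. (b + 1) * Lambda_symbol a 1 * (sin_mode 1 y * deriv (sin_mode 1) y))"
    unfolding Lambda_sin_mode deriv_cos_mode deriv_sin_mode
    using sin_mode_double[of 1] by (intro ext; simp add: q_def)+
  have fc: "fourier_coeff (\<lambda>x. h x * cos_mode 1 x) 2 = (fourier_coeff h 1 + fourier_coeff h 3) / 2"
     "fourier_coeff (\<lambda>x. h x * sin_mode 1 x) 2 = (fourier_coeff h 1 - fourier_coeff h 3) / (2 * \<i>)"
    if "h \<in> Cinf_circle" for h
    using fourier_coeff_mult_cos_mode[OF that, of 1 2] fourier_coeff_mult_sin_mode[OF that, of 1 2] by simp_all
  note fcs = fourier_coeff_add fourier_coeff_cmult fourier_coeff_deriv fc f g C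

  have "A (\<lambda>x. - q * sin_mode 2 x) = (\<lambda>y. 2 * f y * deriv (cos_mode 1) y + cos_mode 1 y * deriv f y)"
    unfolding f_def by (rule euler_eigen[OF _ _ Lambda_cos L(1)]) (intro C)+
  also have "\<dots> = (\<lambda>y. (- 4 * pi) * (f y * sin_mode 1 y) + deriv f y * cos_mode 1 y)"
    by (simp add: deriv_cos_mode fun_eq_iff)
  finally have "fourier_coeff (\<lambda>x. - q * A (sin_mode 2) x) 2 =
     fourier_coeff (\<lambda>y. (- 4 * pi) * (f y * sin_mode 1 y) + deriv f y * cos_mode 1 y) 2"
    by (simp only: A_cmult[OF Cinf_circle_sin_mode])
  then have 1: "of_real (- q) * fourier_coeff (A (sin_mode 2)) 2 =
      of_real (- 4 * pi) * ((F 1 - F 3) / (2 * \<i>)) + (2 * pi * \<i> * F 1 + 6 * pi * \<i> * F 3) / 2"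
    unfolding fourier_coeff_cmult by (simp only: fcs F_def) simp

  have "A (\<lambda>x. q * sin_mode 2 x) = (\<lambda>y. 2 * g y * deriv (sin_mode 1) y + sin_mode 1 y * deriv g y)"
    unfolding g_def by (rule euler_eigen[OF _ _ Lambda_sin L(2)]) (intro C)+
  also have "\<dots> = (\<lambda>y. (4 * pi) * (g y * cos_mode 1 y) + deriv g y * sin_mode 1 y)"
    by (simp add: deriv_sin_mode fun_eq_iff)
  finally have "fourier_coeff (\<lambda>x. q * A (sin_mode 2) x) 2 =
     fourier_coeff (\<lambda>y. (4 * pi) * (g y * cos_mode 1 y) + deriv g y * sin_mode 1 y) 2"
    by (simp only: A_cmult[OF Cinf_circle_sin_mode])
  then have 2: "of_real q * fourier_coeff (A (sin_mode 2)) 2 =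
      of_real (4 * pi) * ((G 1 + G 3) / 2) + (2 * pi * \<i> * G 1 - 6 * pi * \<i> * G 3) / (2 * \<i>)"
    unfolding fourier_coeff_cmult by (simp only: fcs G_def) simp

  have cos2: "cos_mode 2 y = cos_mode 1 y * cos_mode 1 y - sin_mode 1 y * sin_mode 1 y" for y
    using cos_mode_double[of 1] by simp
  have "Lambda_mu a (\<lambda>x. 2 * q * cos_mode 2 x) = (\<lambda>y.
      (b * Lambda_symbol a 1 + Lambda_symbol a 1) * (cos_mode 1 y * deriv (sin_mode 1) y) +
      (b * Lambda_symbol a 1 + Lambda_symbol a 1) * (sin_mode 1 y * deriv (cos_mode 1) y))"
    unfolding Lambda_cos_mode deriv_cos_mode deriv_sin_mode
    by (intro ext) (simp add: cos2 q_def field_simps)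
  then have "A (\<lambda>x. 2 * q * cos_mode 2 x) = (\<lambda>y. 2 * f y * deriv (sin_mode 1) y + 2 * g y * deriv (cos_mode 1) y
      + cos_mode 1 y * deriv g y + sin_mode 1 y * deriv f y)"
    unfolding f_def g_def
    by (intro euler_polarised[OF _ _ _ _ _ Lambda_cos Lambda_sin L]) (intro C)+
  also have "\<dots> = (\<lambda>y. (4 * pi) * (f y * cos_mode 1 y) + (- 4 * pi) * (g y * sin_mode 1 y)
      + deriv g y * cos_mode 1 y + deriv f y * sin_mode 1 y)"
    by (simp add: deriv_sin_mode deriv_cos_mode fun_eq_iff)
  finally have "fourier_coeff (\<lambda>x. 2 * q * A (cos_mode 2) x) 2 =
     fourier_coeff (\<lambda>y. (4 * pi) * (f y * cos_mode 1 y) + (- 4 * pi) * (g y * sin_mode 1 y)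
      + deriv g y * cos_mode 1 y + deriv f y * sin_mode 1 y) 2"
    by (simp only: A_cmult[OF Cinf_circle_cos_mode])
  then have 3: "of_real (2 * q) * fourier_coeff (A (cos_mode 2)) 2 =
      of_real (4 * pi) * ((F 1 + F 3) / 2) + of_real (- 4 * pi) * ((G 1 - G 3) / (2 * \<i>))
      + (2 * pi * \<i> * G 1 + 6 * pi * \<i> * G 3) / 2 + (2 * pi * \<i> * F 1 - 6 * pi * \<i> * F 3) / (2 * \<i>)"
    unfolding fourier_coeff_cmult by (simp only: fcs F_def G_def) (simp add: mult.assoc)

  \<comment> \<open>Cosine equation minus sine equation plus \<open>\<i>\<close> times the mixed
    one. The coefficients \<open>F 3\<close> and \<open>G 3\<close> cancel, as multiplication by
    \<open>fourier_mode 1\<close> only shifts upwards.\<close>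
  have "2 * \<i> * of_real q * mode_matrix 2 2 = of_real (- q) * fourier_coeff (A (sin_mode 2)) 2
      - of_real q * fourier_coeff (A (sin_mode 2)) 2 + \<i> * (of_real (2 * q) * fourier_coeff (A (cos_mode 2)) 2)"
    by (simp add: mode_matrix_def algebra_simps)
  also have "\<dots> = 6 * pi * \<i> * (F 1 + \<i> * G 1)"
    unfolding 1 2 3 by (simp add: field_simps)
  also have "F 1 + \<i> * G 1 = mode_matrix 1 1"
    by (simp add: mode_matrix_def F_def G_def f_def g_def)
  finally have "2 * \<i> * pi * (of_real ((b + 1) / Lambda_symbol a 2) * mode_matrix 2 2) = 2 * \<i> * pi * (3 * mode_matrix 1 1)"
    by (simp add: q_def algebra_simps)
  moreover have "2 * \<i> * complex_of_real pi \<noteq> 0" by simp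
  ultimately show ?thesis by (metis mult_left_cancel)
qed

text \<open>Inserting the diagonal entries at 1 and 2, the symbol at 2 and the factor
  \<open>2 * c / b\<close> cancel, leaving \<open>b + 1 = 3\<close>.\<close>

lemma b_eq_2: "b = 2"
proof -
  obtain c where c: "c \<noteq> 0" "A (\<lambda>x. 1) = (\<lambda>x. c)" by (rule A_one)
  have "3 * of_real (2 * c / b) = complex_of_real ((b + 1) / Lambda_symbol a 2) * of_real (2 * c * Lambda_symbol a 2 / b)"
    using mode_matrix_quadratic by (simp add: mode_matrix_diag[OF c(2)])
  then have "complex_of_real (3 * (2 * c / b)) = of_real ((b + 1) / Lambda_symbol a 2 * (2 * c * Lambda_symbol a 2 / b))"
    by simp
  then have "3 * (2 * c / b) = (b + 1) / Lambda_symbol a 2 * (2 * c * Lambda_symbol a 2 / b)"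
    unfolding of_real_eq_iff .
  then show ?thesis using c(1) b_neq_0 by (simp add: field_simps)
qed

section \<open>Diagonality of \<open>A\<close> for \<open>b = 2\<close>\<close>

lemma mode_matrix_hermitian: "mode_matrix j k = cnj (mode_matrix k j)"
proof -
  note C = Cinf_circle_cos_mode Cinf_circle_sin_mode A_closed
  have comm: "L2_inner u v = L2_inner v u" for u v
    by (simp add: L2_inner_def mult.commute)
  have "L2_inner (A u) v = L2_inner (A v) u" if "u \<in> Cinf_circle" "v \<in> Cinf_circle" for u v
    using A_symmetric[OF that] comm by simp
  then have "L2_inner (A (cos_mode k)) (cos_mode j) = L2_inner (A (cos_mode j)) (cos_mode k)"
    "L2_inner (A (cos_mode k)) (sin_mode j) = L2_inner (A (sin_mode j)) (cos_mode k)"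
    "L2_inner (A (sin_mode k)) (cos_mode j) = L2_inner (A (cos_mode j)) (sin_mode k)"
    "L2_inner (A (sin_mode k)) (sin_mode j) = L2_inner (A (sin_mode j)) (sin_mode k)"
    by (simp_all add: C)
  then show ?thesis
    by (simp add: mode_matrix_def fourier_coeff_eq_L2_inner C complex_eq_iff)
qed

text \<open>An off-diagonal entry at \<open>(j, k)\<close> forces \<open>j = k (1 + 2 / \<bar>k\<bar> powr a)\<close>, hence \<open>\<bar>j\<bar> > \<bar>k\<bar>\<close>;
  by symmetry also \<open>\<bar>k\<bar> > \<bar>j\<bar>\<close>.\<close>

lemma mode_matrix_offdiag:
  assumes jk: "j \<noteq> k"
  shows "mode_matrix j k = 0"
proof (rule ccontr)
  assume nz: "mode_matrix j k \<noteq> 0"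
  obtain c where c: "A (\<lambda>x. 1) = (\<lambda>x. c)" by (rule A_one)
  \<comment> \<open>For \<open>k = 0\<close> no strict inequality is available, but the equation
    then forces \<open>j = 0\<close>, contrary to \<open>j \<noteq> k\<close>.\<close>
  have *: "j = 0 \<and> k = 0 \<or> \<bar>k\<bar> < \<bar>j\<bar>" if jk: "j \<noteq> k" and nz: "mode_matrix j k \<noteq> 0" for j k
  proof -
    have "of_int k * (1 + complex_of_real (2 / Lambda_symbol a k)) = of_int j"
      using mode_matrix_eq[OF c, of k j] jk nz by (simp add: b_eq_2)
    then have "complex_of_real (of_int k * (1 + 2 / Lambda_symbol a k)) = of_real (of_int j)"
      by simp
    then have eq: "of_int k * (1 + 2 / Lambda_symbol a k) = real_of_int j"
      unfolding of_real_eq_iff .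
    show ?thesis
    proof (cases "k = 0")
      case True
      then show ?thesis using eq by simp
    next
      case False
      have "\<bar>real_of_int k\<bar> * 1 < \<bar>of_int k\<bar> * (1 + 2 / Lambda_symbol a k)"
        using False Lambda_symbol_pos[of a k] by (intro mult_strict_left_mono) auto
      also have "\<dots> = \<bar>of_int k * (1 + 2 / Lambda_symbol a k)\<bar>"
        using Lambda_symbol_pos[of a k] by (simp add: abs_mult)
      also have "\<dots> = \<bar>of_int j\<bar>" by (simp only: eq)
      finally show ?thesis by linarith
    qed
  qed
  have "mode_matrix k j \<noteq> 0" using nz mode_matrix_hermitian[of j k] by auto
  from *[OF jk nz] *[OF jk[symmetric] this] jk show False by linarith
qed

text \<open>At \<open>j = k = 0\<close> the relation \<open>mode_matrix_eq\<close> is void, so that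
  entry comes directly from the value of \<open>A\<close> at the constant 1.\<close>

lemma mode_matrix_eq_diag:
  assumes c: "A (\<lambda>x. 1) = (\<lambda>x. c)"
  shows "mode_matrix j k = of_real (c * Lambda_symbol a k) * of_bool (j = k)"
proof (cases "j = k")
  case True
  show ?thesis
  proof (cases "k = 0")
    case k: True
    then show ?thesis using True
      by (simp add: mode_matrix_def cos_mode_0 sin_mode_0 c A_zero fourier_coeff_const)
  next
    case False
    then show ?thesis using True mode_matrix_diag[OF c False] by (simp add: b_eq_2)
  qed
qed (simp add: mode_matrix_offdiag)

section \<open>From the matrix back to the operator\<close>

text \<open>The real modes are the half sum and, up to \<open>\<i>\<close>, the half difference of
  the complex modes at \<open>k\<close> and \<open>- k\<close>.\<close>

lemma A_modes:
  assumes c: "A (\<lambda>x. 1) = (\<lambda>x. c)"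
  shows "A (cos_mode k) = (\<lambda>x. c * Lambda_symbol a k * cos_mode k x)"
    and "A (sin_mode k) = (\<lambda>x. c * Lambda_symbol a k * sin_mode k x)"
proof -
  note C = Cinf_circle_intros A_closed
  have minus: "mode_matrix j (- k) = fourier_coeff (A (cos_mode k)) j - \<i> * fourier_coeff (A (sin_mode k)) j" for j
    unfolding mode_matrix_def cos_mode_minus sin_mode_minus A_cmult[OF Cinf_circle_sin_mode] fourier_coeff_cmult
    by simp
  have "fourier_coeff (A (cos_mode k)) j = (mode_matrix j k + mode_matrix j (- k)) / 2"
    "fourier_coeff (A (sin_mode k)) j = (mode_matrix j k - mode_matrix j (- k)) / (2 * \<i>)" for j
    unfolding minus by (simp_all add: mode_matrix_def)
  then show "A (cos_mode k) = (\<lambda>x. c * Lambda_symbol a k * cos_mode k x)"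
    and "A (sin_mode k) = (\<lambda>x. c * Lambda_symbol a k * sin_mode k x)"
    by (intro Cinf_circle_eqI C;
        simp add: mode_matrix_eq_diag[OF c] fourier_coeff_cmult fourier_coeff_cos_mode fourier_coeff_sin_mode
          distrib_left right_diff_distrib)+
qed

text \<open>Symmetry moves \<open>A\<close> onto the modes, where it is known, so the coefficients
  of \<open>A u\<close> are \<open>c * Lambda_symbol a k\<close> times those of \<open>u\<close>.
  Fourier inversion for \<open>A u\<close> then gives \<open>c\<close> times the series of
  \<open>Lambda_mu a u\<close>.\<close>

lemma A_eq_Lambda:
  assumes c: "A (\<lambda>x. 1) = (\<lambda>x. c)" and u: "u \<in> Cinf_circle"
  shows "A u = (\<lambda>x. c * Lambda_mu a u x)"
proof
  fix x
  have L2: "L2_inner u (\<lambda>x. r * v x) = r * L2_inner u v" for r v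
    by (simp add: L2_inner_def mult.left_commute)
  have "fourier_coeff (A u) k = of_real (c * Lambda_symbol a k) * fourier_coeff u k" for k
    using u by (simp add: fourier_coeff_eq_L2_inner A_closed A_symmetric Cinf_circle_cos_mode
        Cinf_circle_sin_mode A_modes[OF c] L2 complex_eq_iff)
  then have "((\<lambda>k. of_real c * (of_real (Lambda_symbol a k) * fourier_coeff u k * fourier_mode k x))
      has_sum of_real (A u x)) UNIV"
    using Fourier_inversion[OF A_closed[OF u], of x] by (simp add: mult.assoc)
  moreover have "((\<lambda>k. of_real c * (of_real (Lambda_symbol a k) * fourier_coeff u k * fourier_mode k x))
      has_sum of_real c * of_real (Lambda_mu a u x)) UNIV"
    by (intro has_sum_cmult_right Lambda_series u)
  ultimately have "complex_of_real (A u x) = of_real c * of_real (Lambda_mu a u x)"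
    by (rule has_sum_unique)
  then show "A u x = c * Lambda_mu a u x" by (metis of_real_eq_iff of_real_mult)
qed

end

theorem proposition3p1:
  fixes a b :: real
    and A :: "(real \<Rightarrow> real) \<Rightarrow> real \<Rightarrow> real"
  assumes "A \<in> regular_inertia_operators"
    and "is_euler_equation a b A"
    and "a \<noteq> 1 \<or> (a = 1 \<and> - 1 \<le> b)"
  shows "b = 2 \<and> (\<exists>c. c \<noteq> 0 \<and> (\<forall>u\<in>Cinf_circle. A u = (\<lambda>x. c * Lambda_mu a u x)))"
proof -
  interpret euler_inertia a b A using assms by unfold_locales
  \<comment> \<open>The factor \<open>c\<close> is the constant value of \<open>A\<close> at the
    function 1.\<close>
  show ?thesis using b_eq_2 A_eq_Lambda A_one by metis
qed

end
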